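(* Let $\theta\in\mathbb R$ and suppose that $\gamma_\kappa>0$ and $\gamma_\kappa\ge\frac12(1+\theta)^2(\mathtt d_\kappa)^2$ for each $\kappa\in\mathcal K$. Then the bilinear form $a$ is coercive on $\mathbb V_N$ in the sense that $$\tfrac12|\!|\!|v_N|\!|\!|^2\le a(v_N,v_N)\qquad\text{for all }v_N\in\mathbb V_N.$$
   Context: **Mesh.** $\Omega=(0,1)^d$, $d\in\{1,2,3\}$, with its boundary identified periodically; $\mathcal K$ is a regular partition of $\Omega$ into elements $\kappa$: the intersection of the closures of two elements is an element, a common face, edge or vertex of the partition, or empty, and the partition is also regular across $\partial\Omega$ under the periodic identification. **Spaces.** $H^s(\mathcal K)=\{v\in L^2(\Omega): v|_\kappa\in H^s(\kappa)\ \forall\kappa\in\mathcal K\}$. $\mathbb V_N=\bigoplus_{\kappa\in\mathcal K}\mathbb V_N(\kappa)$, where each $\mathbb V_N(\kappa)\subset H^2(\kappa)$ is a finite-dimensional space containing the constant functions (otherwise arbitrary). $(\cdot,\cdot)_D$ and $\|\cdot\|_D$ are the $L^2$ inner product and norm on $D$ ($D=\kappa,\partial\kappa$). **Jumps.** On a face shared by $\kappa,\kappa'$, with exterior unit normals $n_\kappa,n_{\kappa'}$: $[\![v]\!]=v|_\kappa n_\kappa+v|_{\kappa'}n_{\kappa'}$. In $(\cdot,\cdot)_{\partial\kappa}$, the values of non-jump functions on $\partial\kappa$ are traces taken from inside $\kappa$. **Bilinear form and norm.** Given $\theta\in\mathbb R$ and a piecewise constant penalty function $\gamma$ with $\gamma|_\kappa=\gamma_\kappa$,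 for $w,v\in H^2(\mathcal K)$ $$a(w,v)=\sum_{\kappa\in\mathcal K}\Big[(\nabla w,\nabla v)_\kappa-\tfrac12(\nabla w,[\![v]\!])_{\partial\kappa}-\tfrac\theta2([\![w]\!],\nabla v)_{\partial\kappa}+\tfrac{\gamma_\kappa}2([\![w]\!],[\![v]\!])_{\partial\kappa}\Big],$$ and for $v\in H^1(\mathcal K)$, $|\!|\!|v|\!|\!|^2=\sum_{\kappa\in\mathcal K}\big[\|\nabla v\|_\kappa^2+\tfrac{\gamma_\kappa}{2}\|[\![v]\!]\|_{\partial\kappa}^2\big]$. **Local constant.** With $\Pi_0^\kappa v=\frac1{|\kappa|}\int_\kappa v\,dx$ and $\|v\|_{\star,\kappa}^2=\|\Pi_0^\kappa v\|_\kappa^2+\|\nabla v\|_\kappa^2$, $$\mathtt d_\kappa=\sup_{0\ne v_N\in\mathbb V_N(\kappa)}\frac{\|\nabla v_N\cdot n_\kappa\|_{\partial\kappa}}{\|v_N\|_{\star,\kappa}}.$$ *)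

theory Defs
  imports "HOL-Analysis.Analysis"
begin

section \<open>Periodic polyhedral partitions of the unit cube\<close>

definition unit_cube :: "(real^'n) set" where
  "unit_cube = {x. \<forall>i. 0 < x $ i \<and> x $ i < 1}"

definition int_lattice :: "(real^'n) set" where
  "int_lattice = {z. \<forall>i. z $ i \<in> \<int>}"

text \<open>The closure is a finite union of convex polytopes, so elements need not be convex;
  \<open>\<kappa> = interior (closure \<kappa>)\<close> excludes slits.\<close>

definition polyhedral_element :: "(real^'n) set \<Rightarrow> bool" where
  "polyhedral_element \<kappa> \<longleftrightarrow>
     \<kappa> \<noteq> {} \<and> open \<kappa> \<and> connected \<kappa> \<and> \<kappa> = interior (closure \<kappa>) \<and>
     (\<exists>\<P>. finite \<P> \<and> (\<forall>P\<in>\<P>. polytope P) \<and> closure \<kappa> = \<Union>\<P>)"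

text \<open>The faces of all dimensions of a closed, possibly non-convex polyhedron \<open>P\<close>: two points
  have the same local shape if \<open>P\<close> looks the same, up to translation, near both of them, and the
  cells of \<open>P\<close> are the closures of the connected components of the classes of this relation.
  For the closure of an element these are the closed element itself, its facets, its edges, its
  vertices. If \<open>P\<close> is convex, they are its nonempty faces in the sense of \<open>face_of\<close>.\<close>

definition same_local_shape :: "(real^'n) set \<Rightarrow> real^'n \<Rightarrow> real^'n \<Rightarrow> bool" where
  "same_local_shape P x y \<longleftrightarrow>
     (\<exists>r>0. \<forall>h. norm h < r \<longrightarrow> (x + h \<in> P \<longleftrightarrow> y + h \<in> P))"

definition cells :: "(real^'n) set \<Rightarrow> (real^'n) set set" where
  "cells P = {closure C | C. \<exists>x\<in>P. C \<in> components {y\<in>P. same_local_shape P x y}}"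

definition periodic_extension :: "(real^'n) set set \<Rightarrow> (real^'n) set set" where
  "periodic_extension K = {(\<lambda>x. x + z) ` \<kappa> | \<kappa> z. \<kappa> \<in> K \<and> z \<in> int_lattice}"

text \<open>Regularity is imposed on the periodic extension, which is a partition of the whole space.
  On the torus itself the closures of two elements may well share several faces (already for the
  partition of the circle into two intervals); in the periodic extension they share at most one.\<close>

definition regular_periodic_partition :: "(real^'n) set set \<Rightarrow> bool" where
  "regular_periodic_partition K \<longleftrightarrow>
     finite K \<and>
     (\<forall>\<kappa>\<in>K. polyhedral_element \<kappa> \<and> \<kappa> \<subseteq> unit_cube) \<and>
     disjoint K \<and>
     (\<Union>\<kappa>\<in>K. closure \<kappa>) = closure unit_cube \<and>
     (\<forall>\<sigma>\<in>periodic_extension K. \<forall>\<tau>\<in>periodic_extension K.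
        closure \<sigma> \<inter> closure \<tau> = {} \<or>
        closure \<sigma> \<inter> closure \<tau> \<in> cells (closure \<sigma>) \<inter> cells (closure \<tau>))"


section \<open>Surface measure and exterior unit normal\<close>

definition hausdorff_pre :: "nat \<Rightarrow> real \<Rightarrow> (real^'n) set \<Rightarrow> ennreal" where
  "hausdorff_pre m \<delta> A =
     (INF U \<in> {U :: nat \<Rightarrow> (real^'n) set.
               A \<subseteq> (\<Union>i. U i) \<and> (\<forall>i. bounded (U i) \<and> diameter (U i) \<le> \<delta>)}.
        \<Sum>i. if U i = {} then 0
            else ennreal (unit_ball_vol (real m) * (diameter (U i) / 2) ^ m))"

definition hausdorff_outer :: "nat \<Rightarrow> (real^'n) set \<Rightarrow> ennreal" where
  "hausdorff_outer m A = (SUP \<delta>\<in>{0<..}. hausdorff_pre m \<delta> A)"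

text \<open>\<open>hausdorff_outer m\<close> is a metric outer measure, hence countably additive on Borel sets, so
  that \<open>emeasure\<close> of the following measure coincides with it there.\<close>

definition hausdorff :: "nat \<Rightarrow> (real^'n) measure" where
  "hausdorff m = measure_of UNIV (sets borel) (hausdorff_outer m)"

definition surface :: "(real^'n) set \<Rightarrow> (real^'n) measure" where
  "surface \<kappa> = restrict_space (hausdorff (CARD('n) - 1)) (frontier \<kappa>)"

text \<open>\<open>n\<close> is the exterior unit normal of \<open>\<kappa>\<close> at \<open>x\<close> if \<open>\<kappa>\<close> is a half space near \<open>x\<close>. For a
  polyhedral element this determines \<open>n\<close> at all boundary points off the lower dimensional faces,
  which are null sets of the surface measure.\<close>

definition is_outer_normal :: "(real^'n) set \<Rightarrow> real^'n \<Rightarrow> real^'n \<Rightarrow> bool" where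
  "is_outer_normal \<kappa> x n \<longleftrightarrow>
     norm n = 1 \<and> (\<exists>r>0. \<forall>h. norm h < r \<longrightarrow> (x + h \<in> \<kappa> \<longleftrightarrow> h \<bullet> n < 0))"

definition outer_normal :: "(real^'n) set \<Rightarrow> real^'n \<Rightarrow> real^'n" where
  "outer_normal \<kappa> x = (THE n. is_outer_normal \<kappa> x n)"


section \<open>Square-integrable functions, Sobolev spaces and traces\<close>

text \<open>Functions are defined on the whole space, and only their values on the relevant subset
  (up to null sets) matter.\<close>

definition L2 :: "'a measure \<Rightarrow> ('a \<Rightarrow> 'b::euclidean_space) set" where
  "L2 M = {f \<in> borel_measurable M. integrable M (\<lambda>x. (norm (f x))\<^sup>2)}"

definition L2_inner :: "'a measure \<Rightarrow> ('a \<Rightarrow> 'b::euclidean_space) \<Rightarrow> ('a \<Rightarrow> 'b) \<Rightarrow> real" where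
  "L2_inner M f g = (\<integral>x. f x \<bullet> g x \<partial>M)"

definition L2_norm :: "'a measure \<Rightarrow> ('a \<Rightarrow> 'b::euclidean_space) \<Rightarrow> real" where
  "L2_norm M f = sqrt (L2_inner M f f)"

definition partial_deriv :: "'n \<Rightarrow> (real^'n \<Rightarrow> real) \<Rightarrow> real^'n \<Rightarrow> real" where
  "partial_deriv i f x = frechet_derivative f (at x) (axis i 1)"

definition gradient :: "(real^'n \<Rightarrow> real) \<Rightarrow> real^'n \<Rightarrow> real^'n" where
  "gradient f x = (\<chi> i. partial_deriv i f x)"

primrec Ck :: "nat \<Rightarrow> (real^'n \<Rightarrow> real) \<Rightarrow> bool" where
  "Ck 0 f \<longleftrightarrow> continuous_on UNIV f"
| "Ck (Suc k) f \<longleftrightarrow> (\<forall>x. f differentiable (at x)) \<and> (\<forall>i. Ck k (partial_deriv i f))"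

definition smooth :: "(real^'n \<Rightarrow> real) \<Rightarrow> bool" where
  "smooth f \<longleftrightarrow> (\<forall>k. Ck k f)"

definition test_fun :: "(real^'n) set \<Rightarrow> (real^'n \<Rightarrow> real) set" where
  "test_fun \<kappa> = {\<phi>. smooth \<phi> \<and> (\<exists>C. compact C \<and> C \<subseteq> \<kappa> \<and> (\<forall>x. x \<notin> C \<longrightarrow> \<phi> x = 0))}"

definition is_weak_grad ::
    "(real^'n) set \<Rightarrow> (real^'n \<Rightarrow> real) \<Rightarrow> (real^'n \<Rightarrow> real^'n) \<Rightarrow> bool" where
  "is_weak_grad \<kappa> v G \<longleftrightarrow>
     (\<forall>\<phi>\<in>test_fun \<kappa>. \<forall>i. (\<integral>x. v x * partial_deriv i \<phi> x \<partial>lebesgue_on \<kappa>)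
                        = - (\<integral>x. G x $ i * \<phi> x \<partial>lebesgue_on \<kappa>))"

definition H1 :: "(real^'n) set \<Rightarrow> (real^'n \<Rightarrow> real) set" where
  "H1 \<kappa> = {v \<in> L2 (lebesgue_on \<kappa>). \<exists>G \<in> L2 (lebesgue_on \<kappa>). is_weak_grad \<kappa> v G}"

text \<open>For \<open>v \<in> H1 \<kappa>\<close> the weak gradient is unique up to null sets.\<close>

definition weak_grad :: "(real^'n) set \<Rightarrow> (real^'n \<Rightarrow> real) \<Rightarrow> real^'n \<Rightarrow> real^'n" where
  "weak_grad \<kappa> v = (SOME G. G \<in> L2 (lebesgue_on \<kappa>) \<and> is_weak_grad \<kappa> v G)"

definition H2 :: "(real^'n) set \<Rightarrow> (real^'n \<Rightarrow> real) set" where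
  "H2 \<kappa> = {v \<in> H1 \<kappa>. \<forall>i. (\<lambda>x. weak_grad \<kappa> v x $ i) \<in> H1 \<kappa>}"

text \<open>The trace from inside \<open>\<kappa>\<close>: the limit in \<open>L\<^sup>2(\<partial>\<kappa>)\<close> of the boundary values of smooth
  functions that converge to \<open>v\<close> in \<open>H\<^sup>1(\<kappa>)\<close>. By the trace theorem it exists and is unique up to
  null sets for every \<open>v \<in> H1 \<kappa>\<close>; elsewhere \<open>bdry_trace\<close> is set to zero.\<close>

definition is_trace :: "(real^'n) set \<Rightarrow> (real^'n \<Rightarrow> real) \<Rightarrow> (real^'n \<Rightarrow> real) \<Rightarrow> bool" where
  "is_trace \<kappa> v g \<longleftrightarrow>
     v \<in> H1 \<kappa> \<and> g \<in> L2 (surface \<kappa>) \<and>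
     (\<exists>\<phi> :: nat \<Rightarrow> real^'n \<Rightarrow> real.
        (\<forall>k. smooth (\<phi> k)) \<and>
        (\<lambda>k. L2_norm (lebesgue_on \<kappa>) (\<lambda>x. \<phi> k x - v x)) \<longlonglongrightarrow> 0 \<and>
        (\<lambda>k. L2_norm (lebesgue_on \<kappa>) (\<lambda>x. gradient (\<phi> k) x - weak_grad \<kappa> v x)) \<longlonglongrightarrow> 0 \<and>
        (\<lambda>k. L2_norm (surface \<kappa>) (\<lambda>x. \<phi> k x - g x)) \<longlonglongrightarrow> 0)"

definition bdry_trace :: "(real^'n) set \<Rightarrow> (real^'n \<Rightarrow> real) \<Rightarrow> real^'n \<Rightarrow> real" where
  "bdry_trace \<kappa> v = (if \<exists>g. is_trace \<kappa> v g then SOME g. is_trace \<kappa> v g else (\<lambda>_. 0))"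

definition grad_trace :: "(real^'n) set \<Rightarrow> (real^'n \<Rightarrow> real) \<Rightarrow> real^'n \<Rightarrow> real^'n" where
  "grad_trace \<kappa> v x = (\<chi> i. bdry_trace \<kappa> (\<lambda>y. weak_grad \<kappa> v y $ i) x)"


section \<open>The discontinuous Galerkin form\<close>

definition local_space :: "(real^'n) set \<Rightarrow> (real^'n \<Rightarrow> real) set \<Rightarrow> bool" where
  "local_space \<kappa> W \<longleftrightarrow>
     W \<subseteq> H2 \<kappa> \<and>
     (\<forall>c. (\<lambda>_. c) \<in> W) \<and>
     (\<forall>u\<in>W. \<forall>v\<in>W. (\<lambda>x. u x + v x) \<in> W) \<and>
     (\<forall>c. \<forall>v\<in>W. (\<lambda>x. c * v x) \<in> W) \<and>
     (\<exists>B\<subseteq>W. finite B \<and>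
        (\<forall>v\<in>W. \<exists>c. AE x in lebesgue_on \<kappa>. v x = (\<Sum>b\<in>B. c b * b x)))"

definition dg_space ::
    "(real^'n) set set \<Rightarrow> ((real^'n) set \<Rightarrow> (real^'n \<Rightarrow> real) set) \<Rightarrow> (real^'n \<Rightarrow> real) set" where
  "dg_space K V = {v. \<forall>\<kappa>\<in>K. \<exists>u\<in>V \<kappa>. AE x in lebesgue_on \<kappa>. v x = u x}"

text \<open>The elements \<open>\<kappa> + z\<close> of the periodic extension, as pairs \<open>(\<kappa>, z)\<close>, that have \<open>x\<close> in the
  relative interior of a face. For almost every point \<open>x\<close> of the skeleton there are exactly two of
  them, the two sides of the face. For a face on the boundary of the unit cube they lie on
  opposite sides of the cube, and may come from the same \<open>\<kappa>\<close>.\<close>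

definition adjacent :: "(real^'n) set set \<Rightarrow> real^'n \<Rightarrow> ((real^'n) set \<times> (real^'n)) set" where
  "adjacent K x = {(\<kappa>, z). \<kappa> \<in> K \<and> z \<in> int_lattice \<and> (\<exists>n. is_outer_normal \<kappa> (x - z) n)}"

definition jump :: "(real^'n) set set \<Rightarrow> (real^'n \<Rightarrow> real) \<Rightarrow> real^'n \<Rightarrow> real^'n" where
  "jump K v x =
     (if card (adjacent K x) = 2
      then \<Sum>(\<kappa>, z)\<in>adjacent K x. bdry_trace \<kappa> v (x - z) *\<^sub>R outer_normal \<kappa> (x - z)
      else 0)"

definition dg_form ::
    "(real^'n) set set \<Rightarrow> real \<Rightarrow> ((real^'n) set \<Rightarrow> real) \<Rightarrow>
     (real^'n \<Rightarrow> real) \<Rightarrow> (real^'n \<Rightarrow> real) \<Rightarrow> real" where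
  "dg_form K \<theta> \<gamma> w v =
     (\<Sum>\<kappa>\<in>K. L2_inner (lebesgue_on \<kappa>) (weak_grad \<kappa> w) (weak_grad \<kappa> v)
        - 1/2 * L2_inner (surface \<kappa>) (grad_trace \<kappa> w) (jump K v)
        - \<theta>/2 * L2_inner (surface \<kappa>) (jump K w) (grad_trace \<kappa> v)
        + \<gamma> \<kappa> / 2 * L2_inner (surface \<kappa>) (jump K w) (jump K v))"

definition dg_norm ::
    "(real^'n) set set \<Rightarrow> ((real^'n) set \<Rightarrow> real) \<Rightarrow> (real^'n \<Rightarrow> real) \<Rightarrow> real" where
  "dg_norm K \<gamma> v =
     sqrt (\<Sum>\<kappa>\<in>K. (L2_norm (lebesgue_on \<kappa>) (weak_grad \<kappa> v))\<^sup>2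
        + \<gamma> \<kappa> / 2 * (L2_norm (surface \<kappa>) (jump K v))\<^sup>2)"

definition mean_value :: "(real^'n) set \<Rightarrow> (real^'n \<Rightarrow> real) \<Rightarrow> real" where
  "mean_value \<kappa> v = (\<integral>x. v x \<partial>lebesgue_on \<kappa>) / measure lebesgue \<kappa>"

definition star_norm :: "(real^'n) set \<Rightarrow> (real^'n \<Rightarrow> real) \<Rightarrow> real" where
  "star_norm \<kappa> v =
     sqrt ((L2_norm (lebesgue_on \<kappa>) (\<lambda>_. mean_value \<kappa> v))\<^sup>2
         + (L2_norm (lebesgue_on \<kappa>) (weak_grad \<kappa> v))\<^sup>2)"

text \<open>The supremum is taken in the extended reals, so that no junk value can arise; it is finite
  because \<open>W\<close> has finite dimension.\<close>

definition d_const :: "(real^'n) set \<Rightarrow> (real^'n \<Rightarrow> real) set \<Rightarrow> ereal" where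
  "d_const \<kappa> W =
     (SUP v\<in>{v\<in>W. \<not> (AE x in lebesgue_on \<kappa>. v x = 0)}.
        ereal (L2_norm (surface \<kappa>) (\<lambda>x. grad_trace \<kappa> v x \<bullet> outer_normal \<kappa> x)
               / star_norm \<kappa> v))"

end

theory Submission
  imports Defs
begin

text \<open>Summing over the elements, it suffices to absorb the flux term
  \<open>(1 + \<theta>)/2 (\<nabla>v, [v])\<close> on each \<open>\<partial>\<kappa>\<close>. The two sides of a face have opposite normals, so the jump is
  parallel to the normal of \<open>\<kappa>\<close> and only the normal derivative enters; Young's inequality then
  leaves half of the jump penalty and a multiple of the squared norm of the normal derivative.
  The latter is at most \<open>d\<^sup>2 \<parallel>\<nabla>v\<parallel>\<^sup>2\<close>, because constants may be subtracted from \<open>v\<close> without changing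
  its gradient, which removes the mean value from the star norm.\<close>


section \<open>Outer normals and the direction of jumps\<close>

text \<open>Integrals of non-integrable functions are 0 by convention, so the inequality between the
  integrands can be integrated only once the normal derivative and the jump are known to be square
  integrable on the boundary. For the jump this is not a local matter: it takes the trace from a
  neighbouring element, possibly at a point shifted by a lattice vector, and it is set to 0 unless
  exactly two sides are found. This is why measurability of the normal, translation invariance of
  the surface measure and a finite description of adjacency are established. The direction of the
  jump, in contrast, is settled at every single frontier point where the jump is nonzero, from the
  geometry of half spaces alone. The threshold for \<gamma> comes from completing the square:
  granting the jump half of its penalty, \<open>\<gamma> / 4\<close>, leaves the factor
  \<open>(1 + \<theta>)\<^sup>2 / (4 * \<gamma>)\<close> on the squared normal derivative, and its
  product with \<open>d\<^sup>2\<close> is at most 1/2 precisely when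
  \<open>\<gamma> \<ge> 1/2 * (1 + \<theta>)\<^sup>2 * d\<^sup>2\<close>.\<close>

lemma is_outer_normalE:
  assumes "is_outer_normal \<kappa> x n"
  obtains r where "r > 0" "\<And>h. norm h < r \<Longrightarrow> (x + h \<in> \<kappa> \<longleftrightarrow> h \<bullet> n < 0)" "norm n = 1"
proof -
  from assms obtain r where "norm n = 1" "r > 0" and r: "\<forall>h. norm h < r \<longrightarrow> (x + h \<in> \<kappa> \<longleftrightarrow> h \<bullet> n < 0)"
    unfolding is_outer_normal_def by (elim conjE exE) (rule that)
  then show thesis by (intro that[of r]) simp_all
qed

lemma outer_normal_eq:
  assumes "is_outer_normal \<kappa> x n"
  shows "outer_normal \<kappa> x = n"
proof -
  have "m = n" if onm: "is_outer_normal \<kappa> x m" for m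
  proof (rule ccontr)
    assume "m \<noteq> n"
    obtain r where r: "r > 0" "\<And>h. norm h < r \<Longrightarrow> (x + h \<in> \<kappa> \<longleftrightarrow> h \<bullet> n < 0)" and n: "norm n = 1"
      by (fact is_outer_normalE[OF assms(1)])
    obtain s where s: "s > 0" "\<And>h. norm h < s \<Longrightarrow> (x + h \<in> \<kappa> \<longleftrightarrow> h \<bullet> m < 0)" and m: "norm m = 1"
      by (fact is_outer_normalE[OF onm])
    \<comment> \<open>Two different unit vectors are separated by their difference: a small multiple
      of \<open>m - n\<close> has negative product with \<open>n\<close> and positive product with
      \<open>m\<close>, so the two normals disagree on whether that point lies in the
      element.\<close>
    define e where "e = min r s / 2 / norm (m - n)"
    have e: "e > 0" "norm (e *\<^sub>R (m - n)) < r" "norm (e *\<^sub>R (m - n)) < s"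
      using \<open>m \<noteq> n\<close> r(1) s(1) by (auto simp: e_def)
    have nn: "n \<bullet> n = 1" "m \<bullet> m = 1" using n m by (simp_all add: norm_eq_1)
    have "(m - n) \<bullet> (m - n) > 0" using \<open>m \<noteq> n\<close> by simp
    then have lt: "m \<bullet> n < 1" using nn by (simp add: algebra_simps inner_commute)
    have "(e *\<^sub>R (m - n)) \<bullet> n < 0"
      using lt nn e(1) by (simp add: algebra_simps mult_pos_neg)
    moreover have "\<not> (e *\<^sub>R (m - n)) \<bullet> m < 0"
      using lt nn e(1) by (simp add: algebra_simps inner_commute)
    ultimately show False using r(2)[OF e(2)] s(2)[OF e(3)] by blast
  qed
  then show ?thesis unfolding outer_normal_def using assms by blast
qed

lemma is_outer_normal_frontier:
  assumes "is_outer_normal \<kappa> x n" "open \<kappa>"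
  shows "x \<in> frontier \<kappa>"
proof -
  obtain r where r: "r > 0" "\<And>h. norm h < r \<Longrightarrow> (x + h \<in> \<kappa> \<longleftrightarrow> h \<bullet> n < 0)" and n: "norm n = 1"
    by (fact is_outer_normalE[OF assms(1)])
  have "x \<notin> \<kappa>" using r(2)[of 0] r(1) by simp
  moreover have "x \<in> closure \<kappa>"
    unfolding closure_approachable
  proof (intro allI impI)
    fix e :: real assume "e > 0"
    define t where "t = min e r / 2"
    have t: "t > 0" "t < e" "t < r" using \<open>e > 0\<close> r(1) by (auto simp: t_def)
    have "x + (- t) *\<^sub>R n \<in> \<kappa>"
      using r(2)[of "(- t) *\<^sub>R n"] t n by (simp add: dot_square_norm)
    moreover have "dist (x + (- t) *\<^sub>R n) x < e" using t n by (simp add: dist_norm)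
    ultimately show "\<exists>y\<in>\<kappa>. dist y x < e" by blast
  qed
  ultimately show ?thesis using assms(2) by (simp add: frontier_def interior_open)
qed

text \<open>Near \<open>x\<close> the frontier is a piece of the hyperplane orthogonal to
  \<open>n\<close>, and half of the radius is left around each of its points. Both the relative
  openness of the flat part and the continuity of the normal on it rest on this.\<close>

lemma is_outer_normal_locally_constant:
  assumes "is_outer_normal \<kappa> x n" "open \<kappa>"
  shows "\<exists>r>0. \<forall>y\<in>frontier \<kappa> \<inter> ball x r. is_outer_normal \<kappa> y n"
proof -
  obtain r where r: "r > 0" "\<And>h. norm h < r \<Longrightarrow> (x + h \<in> \<kappa> \<longleftrightarrow> h \<bullet> n < 0)" and n: "norm n = 1"
    by (fact is_outer_normalE[OF assms(1)])
  have r': "y \<in> \<kappa> \<longleftrightarrow> (y - x) \<bullet> n < 0" if "dist x y < r" for y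
    using r(2)[of "y - x"] that by (simp add: dist_norm norm_minus_commute)
  have "is_outer_normal \<kappa> y n" if y: "y \<in> frontier \<kappa>" "dist x y < r / 2" for y
  proof -
    have "y \<notin> \<kappa>" "y \<in> closure \<kappa>" using y(1) assms(2) by (auto simp: frontier_def interior_open)
    then have ge: "(y - x) \<bullet> n \<ge> 0" using r'[of y] y(2) r(1) by auto
    have "\<not> (y - x) \<bullet> n > 0"
    proof
      assume pos: "(y - x) \<bullet> n > 0"
      have "open (ball x r \<inter> {z. (z - x) \<bullet> n > 0})"
        by (intro open_Int open_ball open_Collect_less continuous_intros)
      moreover have "y \<in> ball x r \<inter> {z. (z - x) \<bullet> n > 0}" using pos y(2) r(1) by auto
      moreover have "\<kappa> \<inter> (ball x r \<inter> {z. (z - x) \<bullet> n > 0}) = {}"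
        using r' by fastforce
      ultimately show False
        using \<open>y \<in> closure \<kappa>\<close> by (meson Int_commute disjoint_iff open_Int_closure_eq_empty)
    qed
    with ge have "(y - x) \<bullet> n = 0" by simp
    moreover have "y + h \<in> \<kappa> \<longleftrightarrow> (y + h - x) \<bullet> n < 0" if "norm h < r / 2" for h
    proof -
      have "dist x (y + h) \<le> dist x y + norm h"
        using norm_triangle_ineq[of "y - x" h] by (simp add: dist_norm norm_minus_commute algebra_simps)
      then show ?thesis using r'[of "y + h"] that y(2) by simp
    qed
    ultimately have "y + h \<in> \<kappa> \<longleftrightarrow> h \<bullet> n < 0" if "norm h < r / 2" for h
      using that by (simp add: inner_diff_left inner_add_left)
    then show ?thesis
      unfolding is_outer_normal_def using n r(1) by (intro conjI exI[of _ "r/2"]) auto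
  qed
  then show ?thesis using r(1) by (intro exI[of _ "r/2"]) auto
qed

text \<open>The points where \<open>outer_normal\<close> is meaningful; for a polyhedral element
  these form the frontier without its lower dimensional faces.\<close>

definition flat_boundary :: "(real^'n) set \<Rightarrow> (real^'n) set" where
  "flat_boundary \<kappa> = {x. \<exists>n. is_outer_normal \<kappa> x n}"

lemma is_outer_normal_outer_normal:
  "x \<in> flat_boundary \<kappa> \<Longrightarrow> is_outer_normal \<kappa> x (outer_normal \<kappa> x)"
  unfolding flat_boundary_def using outer_normal_eq by fastforce

lemma norm_outer_normal: "x \<in> flat_boundary \<kappa> \<Longrightarrow> norm (outer_normal \<kappa> x) = 1"
  using is_outer_normal_outer_normal is_outer_normal_def by blast

lemma flat_boundary_subset: "open \<kappa> \<Longrightarrow> flat_boundary \<kappa> \<subseteq> frontier \<kappa>"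
  unfolding flat_boundary_def using is_outer_normal_frontier by blast

text \<open>The default value is unknown but does not depend on \<open>x\<close> or \<kappa>; being
  constant there, the normal is still measurable and bounded on the whole space.\<close>

lemma outer_normal_outside_flat_boundary:
  assumes "x \<notin> flat_boundary \<kappa>"
  shows "outer_normal \<kappa> x = (THE n. False)"
proof -
  have "is_outer_normal \<kappa> x = (\<lambda>n. False)"
    using assms by (auto simp: flat_boundary_def)
  then show ?thesis by (simp only: outer_normal_def)
qed

lemma openin_flat_boundary:
  assumes "open \<kappa>"
  shows "openin (top_of_set (frontier \<kappa>)) (flat_boundary \<kappa>)"
proof (subst openin_contains_ball, intro conjI ballI)
  show "flat_boundary \<kappa> \<subseteq> frontier \<kappa>" using flat_boundary_subset[OF assms] .
  fix x assume "x \<in> flat_boundary \<kappa>"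
  then obtain n where "is_outer_normal \<kappa> x n" by (auto simp: flat_boundary_def)
  from is_outer_normal_locally_constant[OF this assms]
  show "\<exists>e>0. ball x e \<inter> frontier \<kappa> \<subseteq> flat_boundary \<kappa>"
    by (auto simp: flat_boundary_def)
qed

lemma flat_boundary_borel: "open \<kappa> \<Longrightarrow> flat_boundary \<kappa> \<in> sets borel"
  using openin_flat_boundary unfolding openin_open
  by (metis borel_closed borel_open frontier_closed sets.Int)

lemma continuous_on_outer_normal:
  fixes \<kappa> :: "(real^'n) set"
  assumes "open \<kappa>"
  shows "continuous_on (flat_boundary \<kappa>) (outer_normal \<kappa>)"
  unfolding continuous_on_iff
proof (intro ballI allI impI)
  fix x :: "real^'n" and e :: real assume x: "x \<in> flat_boundary \<kappa>" and e: "e > 0"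
  from is_outer_normal_locally_constant[OF is_outer_normal_outer_normal[OF x] assms]
  obtain r where "r > 0" "\<And>y. y \<in> frontier \<kappa> \<Longrightarrow> dist x y < r \<Longrightarrow> outer_normal \<kappa> y = outer_normal \<kappa> x"
    using outer_normal_eq by (metis IntI mem_ball)
  then show "\<exists>d>0. \<forall>y\<in>flat_boundary \<kappa>. dist y x < d \<longrightarrow> dist (outer_normal \<kappa> y) (outer_normal \<kappa> x) < e"
    using e flat_boundary_subset[OF assms] by (intro exI[of _ r]) (auto simp: dist_commute)
qed

lemma outer_normal_measurable:
  assumes "open \<kappa>"
  shows "outer_normal \<kappa> \<in> borel_measurable borel"
proof -
  have "(\<lambda>x. indicator (flat_boundary \<kappa>) x *\<^sub>R outer_normal \<kappa> x) \<in> borel_measurable borel"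
    by (rule borel_measurable_continuous_on_indicator[OF flat_boundary_borel[OF assms]
          continuous_on_outer_normal[OF assms]])
  then have "(\<lambda>x. if x \<in> flat_boundary \<kappa> then indicator (flat_boundary \<kappa>) x *\<^sub>R outer_normal \<kappa> x
      else (THE n. False)) \<in> borel_measurable borel"
    using flat_boundary_borel[OF assms] by (intro measurable_If_set) auto
  also have "(\<lambda>x. if x \<in> flat_boundary \<kappa> then indicator (flat_boundary \<kappa>) x *\<^sub>R outer_normal \<kappa> x
      else (THE n. False)) = outer_normal \<kappa>"
    by (auto simp: fun_eq_iff outer_normal_outside_flat_boundary)
  finally show ?thesis .
qed

text \<open>Unless \<open>n' = - n\<close>, the direction \<open>- (n + n')\<close> points into both
  half spaces, and a short step along it reaches a common point. The shifts allow for faces that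
  meet only under the periodic identification.\<close>

lemma outer_normals_of_disjoint_opposite:
  assumes "is_outer_normal \<kappa> (x - z) n" "is_outer_normal \<kappa>' (x - z') n'"
    and disj: "\<And>y. \<not> (y - z \<in> \<kappa> \<and> y - z' \<in> \<kappa>')"
  shows "n' = - n"
proof (rule ccontr)
  assume "n' \<noteq> - n"
  obtain r where r: "r > 0" "\<And>h. norm h < r \<Longrightarrow> (x - z + h \<in> \<kappa> \<longleftrightarrow> h \<bullet> n < 0)" and n: "norm n = 1"
    by (fact is_outer_normalE[OF assms(1)])
  obtain s where s: "s > 0" "\<And>h. norm h < s \<Longrightarrow> (x - z' + h \<in> \<kappa>' \<longleftrightarrow> h \<bullet> n' < 0)" and n': "norm n' = 1"
    by (fact is_outer_normalE[OF assms(2)])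
  have ne: "n + n' \<noteq> 0" using \<open>n' \<noteq> - n\<close> by (metis add_eq_0_iff)
  define e where "e = min r s / 2 / norm (n + n')"
  define h where "h = - (e *\<^sub>R (n + n'))"
  have e: "e > 0" "norm h < r" "norm h < s"
    using ne r(1) s(1) by (auto simp: e_def h_def)
  have nn: "n \<bullet> n = 1" "n' \<bullet> n' = 1" using n n' by (simp_all add: norm_eq_1)
  have "(n + n') \<bullet> (n + n') > 0" using ne by simp
  then have lt: "1 + n \<bullet> n' > 0" using nn by (simp add: algebra_simps inner_commute)
  have "h \<bullet> n = - (e * (1 + n \<bullet> n'))" "h \<bullet> n' = - (e * (1 + n \<bullet> n'))"
    using nn by (simp_all add: h_def algebra_simps inner_commute)
  then have "h \<bullet> n < 0" "h \<bullet> n' < 0" using lt e(1) by simp_all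
  then have "x - z + h \<in> \<kappa>" "x - z' + h \<in> \<kappa>'" using r(2) s(2) e by auto
  then show False using disj[of "x + h"] by (simp add: algebra_simps)
qed

lemma unit_cube_translates_disjoint:
  fixes a b :: "real^'n"
  assumes "a \<in> unit_cube" "b \<in> unit_cube" "a - b \<in> int_lattice"
  shows "a = b"
proof -
  have "a $ i - b $ i = 0" for i
  proof -
    have "a $ i - b $ i \<in> \<int>" using assms(3) by (simp add: int_lattice_def)
    moreover have "\<bar>a $ i - b $ i\<bar> < 1"
      using assms(1,2) unfolding unit_cube_def by (auto simp: abs_less_iff) (smt (verit))+
    ultimately show ?thesis by (metis Ints_nonzero_abs_less1)
  qed
  then show ?thesis by (simp add: vec_eq_iff)
qed

lemma int_lattice_diff: "a \<in> int_lattice \<Longrightarrow> b \<in> int_lattice \<Longrightarrow> a - b \<in> int_lattice"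
  by (simp add: int_lattice_def)

text \<open>Pairs with the same element and different shifts are included, since an element may face
  its own translate across the boundary of the cube.\<close>

lemma translated_elements_disjoint:
  assumes K: "regular_periodic_partition K" and "\<kappa> \<in> K" "\<kappa>' \<in> K" "z \<in> int_lattice" "z' \<in> int_lattice"
    and "(\<kappa>, z) \<noteq> (\<kappa>', z')"
  shows "\<not> (y - z \<in> \<kappa> \<and> y - z' \<in> \<kappa>')"
proof
  assume y: "y - z \<in> \<kappa> \<and> y - z' \<in> \<kappa>'"
  then have "y - z \<in> unit_cube" "y - z' \<in> unit_cube"
    using K assms(2,3) unfolding regular_periodic_partition_def by blast+
  moreover have "(y - z) - (y - z') \<in> int_lattice" using int_lattice_diff[of z' z] assms by simp
  ultimately have "z = z'" using unit_cube_translates_disjoint by fastforce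
  moreover have "\<kappa> = \<kappa>'"
    using K y assms(2,3) \<open>z = z'\<close> unfolding regular_periodic_partition_def
    by (metis disjointD disjoint_iff)
  ultimately show False using assms(6) by simp
qed

text \<open>Two opposite half spaces leave no room for a third open element near \<open>x\<close>, so one of the two
  sides of the face must be \<open>\<kappa>\<close> itself.\<close>

lemma jump_parallel_outer_normal:
  assumes K: "regular_periodic_partition K" and \<kappa>: "\<kappa> \<in> K" and x: "x \<in> frontier \<kappa>"
    and "jump K v x \<noteq> 0"
  shows "x \<in> flat_boundary \<kappa>" "\<exists>s. jump K v x = s *\<^sub>R outer_normal \<kappa> x"
proof -
  have card: "card (adjacent K x) = 2" using assms(4) by (auto simp: jump_def split: if_splits)
  then obtain p q where pq: "adjacent K x = {p, q}" "p \<noteq> q" by (meson card_2_iff)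
  obtain a y where p: "p = (a, y)" by (cases p)
  obtain b z where q: "q = (b, z)" by (cases q)
  have "(a, y) \<in> adjacent K x" "(b, z) \<in> adjacent K x" using pq p q by auto
  then obtain n n' where a: "a \<in> K" "y \<in> int_lattice" "is_outer_normal a (x - y) n"
    and b: "b \<in> K" "z \<in> int_lattice" "is_outer_normal b (x - z) n'"
    by (auto simp: adjacent_def)
  have n': "n' = - n"
    using outer_normals_of_disjoint_opposite[OF a(3) b(3)]
      translated_elements_disjoint[OF K a(1) b(1) a(2) b(2)] pq p q by blast
  have zero: "(0 :: real^'n) \<in> int_lattice" by (simp add: int_lattice_def)
  have op: "open \<kappa>" using K \<kappa> by (simp add: regular_periodic_partition_def polyhedral_element_def)
  have in_pq: "(\<kappa>, 0) = p \<or> (\<kappa>, 0) = q"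
  proof (rule ccontr)
    assume "\<not> ?thesis"
    then have da: "\<And>w. \<not> (w - 0 \<in> \<kappa> \<and> w - y \<in> a)" and db: "\<And>w. \<not> (w - 0 \<in> \<kappa> \<and> w - z \<in> b)"
      using translated_elements_disjoint[OF K \<kappa> a(1) zero a(2)]
        translated_elements_disjoint[OF K \<kappa> b(1) zero b(2)] p q by blast+
    obtain r where r: "r > 0" "\<And>h. norm h < r \<Longrightarrow> (x - y + h \<in> a \<longleftrightarrow> h \<bullet> n < 0)" and n: "norm n = 1"
      by (fact is_outer_normalE[OF a(3)])
    obtain s where s: "s > 0" "\<And>h. norm h < s \<Longrightarrow> (x - z + h \<in> b \<longleftrightarrow> h \<bullet> n' < 0)" and "norm n' = 1"
      by (fact is_outer_normalE[OF b(3)])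
    \<comment> \<open>The translates of \<open>a\<close> and \<open>b\<close> fill the two open half
      spaces near \<open>x\<close>, which confines \<kappa> to the hyperplane between them.\<close>
    have orth: "h \<bullet> n = 0" if "norm h < min r s" "x + h \<in> \<kappa>" for h
    proof -
      have "\<not> h \<bullet> n < 0" using da[of "x + h"] r(2)[of h] that by (auto simp: algebra_simps)
      moreover have "\<not> h \<bullet> n' < 0" using db[of "x + h"] s(2)[of h] that by (auto simp: algebra_simps)
      ultimately show ?thesis using n' by simp
    qed
    have "x \<in> closure \<kappa>" using x by (simp add: frontier_def)
    then obtain w where w: "w \<in> \<kappa>" "dist w x < min r s" "norm (w - x) < min r s"
      using r(1) s(1) unfolding closure_approachable by (metis dist_norm min_less_iff_conj)
    have "open (\<kappa> \<inter> ball x (min r s))" using op by auto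
    moreover have "w \<in> \<kappa> \<inter> ball x (min r s)" using w by (simp add: dist_commute)
    ultimately obtain e where e: "e > 0" "\<And>u. dist u w < e \<Longrightarrow> u \<in> \<kappa> \<inter> ball x (min r s)"
      unfolding open_dist by blast
    \<comment> \<open>As \<kappa> is open, \<open>w\<close> can be moved a little along
      \<open>n\<close> within \<kappa>, which takes it off that hyperplane.\<close>
    define u where "u = w + (e / 2) *\<^sub>R n"
    have "dist u w < e" using e(1) n by (simp add: u_def dist_norm)
    then have u: "u \<in> \<kappa>" "norm (u - x) < min r s"
      using e(2)[of u] by (auto simp: dist_norm norm_minus_commute)
    have "(w - x) \<bullet> n = 0" "(u - x) \<bullet> n = 0" using orth[of "w - x"] orth[of "u - x"] w u by auto
    then have "(u - w) \<bullet> n = 0" by (simp add: inner_diff_left)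
    then have "(e / 2) * (n \<bullet> n) = 0" by (simp add: u_def)
    then show False using e(1) n by (simp add: dot_square_norm)
  qed
  have na: "outer_normal a (x - y) = n" and nb: "outer_normal b (x - z) = - n"
    using outer_normal_eq a(3) b(3) n' by auto
  have J: "jump K v x = (bdry_trace a v (x - y) - bdry_trace b v (x - z)) *\<^sub>R n"
    using card pq p q na nb by (simp add: jump_def scaleR_diff_left)
  show "x \<in> flat_boundary \<kappa>"
    using in_pq p q a b by (auto simp: flat_boundary_def)
  have "outer_normal \<kappa> x = n \<or> outer_normal \<kappa> x = - n"
    using in_pq p q na nb by auto
  then show "\<exists>s. jump K v x = s *\<^sub>R outer_normal \<kappa> x"
    unfolding J by (metis minus_minus scaleR_left.minus scaleR_right.minus)
qed


section \<open>Square integrability on the boundary\<close>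

lemma diameter_translation:
  fixes S :: "'a::real_normed_vector set"
  shows "diameter ((\<lambda>x. x + z) ` S) = diameter S"
proof -
  have "(\<lambda>(x, y). dist x y) ` ((\<lambda>x. x + z) ` S \<times> (\<lambda>x. x + z) ` S) = (\<lambda>(x, y). dist x y) ` (S \<times> S)"
    by (force simp: image_iff)
  then show ?thesis by (simp add: diameter_def)
qed

lemma bounded_translation_iff:
  fixes S :: "'a::real_normed_vector set"
  shows "bounded ((\<lambda>x. x + z) ` S) \<longleftrightarrow> bounded S"
proof -
  have "S = (\<lambda>x. - z + x) ` ((\<lambda>x. x + z) ` S)" by (auto simp: image_image)
  then show ?thesis
    using bounded_translation[of S z] bounded_translation[of "(\<lambda>x. x + z) ` S" "- z"]
    by (auto simp: add.commute)
qed

lemma hausdorff_pre_translation_le: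
  fixes A :: "(real^'n) set"
  shows "hausdorff_pre m \<delta> ((\<lambda>x. x + z) ` A) \<le> hausdorff_pre m \<delta> A"
  unfolding hausdorff_pre_def
proof (rule INF_greatest)
  fix U :: "nat \<Rightarrow> (real^'n) set"
  assume U: "U \<in> {U. A \<subseteq> (\<Union>i. U i) \<and> (\<forall>i. bounded (U i) \<and> diameter (U i) \<le> \<delta>)}"
  show "(INF U\<in>{U. (\<lambda>x. x + z) ` A \<subseteq> (\<Union>i. U i) \<and> (\<forall>i. bounded (U i) \<and> diameter (U i) \<le> \<delta>)}.
       \<Sum>i. if U i = {} then 0 else ennreal (unit_ball_vol (real m) * (diameter (U i) / 2) ^ m))
     \<le> (\<Sum>i. if U i = {} then 0 else ennreal (unit_ball_vol (real m) * (diameter (U i) / 2) ^ m))"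
  proof (rule INF_lower2)
    show "(\<lambda>i. (\<lambda>x. x + z) ` U i) \<in>
       {U. (\<lambda>x. x + z) ` A \<subseteq> (\<Union>i. U i) \<and> (\<forall>i. bounded (U i) \<and> diameter (U i) \<le> \<delta>)}"
      using U by (simp flip: image_UN add: image_mono bounded_translation_iff diameter_translation)
  qed (simp add: diameter_translation cong: if_cong)
qed

lemma hausdorff_outer_translation:
  "hausdorff_outer m ((\<lambda>x. x + z) ` A) = hausdorff_outer m A"
proof -
  have "hausdorff_pre m \<delta> ((\<lambda>x. x + z) ` A) = hausdorff_pre m \<delta> A" for \<delta>
    using hausdorff_pre_translation_le[of m \<delta> z A]
      hausdorff_pre_translation_le[of m \<delta> "- z" "(\<lambda>x. x + z) ` A"]
    by (intro antisym) (auto simp: image_image)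
  then show ?thesis by (simp add: hausdorff_outer_def)
qed

lemma sets_hausdorff [simp, measurable_cong]: "sets (hausdorff m) = sets borel"
  unfolding hausdorff_def using sets.sigma_sets_eq[of borel]
  by (simp add: sets_measure_of_conv)

lemma space_hausdorff [simp]: "space (hausdorff m) = UNIV"
  by (simp add: hausdorff_def)

text \<open>By definition \<open>measure_of\<close> returns either the outer measure on Borel sets
  or the zero measure; \<open>emeasure_measure_of_conv\<close> treats both cases, and both are
  translation invariant.\<close>

lemma emeasure_hausdorff_translation:
  fixes A :: "(real^'n) set"
  assumes "A \<in> sets borel"
  shows "emeasure (hausdorff m) ((\<lambda>x. x + z) ` A) = emeasure (hausdorff m) A"
proof -
  have "(\<lambda>x. x + z) ` A = (\<lambda>x. x - z) -` A \<inter> space borel" by (force simp: image_iff)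
  then have "(\<lambda>x. x + z) ` A \<in> sets borel"
    using measurable_sets[OF _ assms, of "\<lambda>x. x - z" borel] by simp
  then show ?thesis
    using assms sets.sigma_sets_eq[of "borel :: (real^'n) measure"]
    by (simp add: hausdorff_def emeasure_measure_of_conv hausdorff_outer_translation)
qed

lemma distr_hausdorff_translation:
  fixes z :: "real^'n"
  shows "distr (hausdorff m) borel (\<lambda>x. x - z) = hausdorff m"
proof (rule measure_eqI)
  fix A :: "(real^'n) set" assume "A \<in> sets (distr (hausdorff m) borel (\<lambda>x. x - z))"
  then have A: "A \<in> sets borel" by simp
  have "(\<lambda>x. x - z) -` A = (\<lambda>x. x + z) ` A" by (force simp: image_iff)
  then show "emeasure (distr (hausdorff m) borel (\<lambda>x. x - z)) A = emeasure (hausdorff m) A"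
    using A emeasure_hausdorff_translation[OF A] by (simp add: emeasure_distr)
qed simp

section \<open>Closure properties of square integrable functions, and their transfer to the
  boundary\<close>

lemma L2_measurable: "f \<in> L2 M \<Longrightarrow> f \<in> borel_measurable M"
  by (simp add: L2_def)

lemma L2_integrable_square: "f \<in> L2 M \<Longrightarrow> integrable M (\<lambda>x. (norm (f x))\<^sup>2)"
  by (simp add: L2_def)

lemma L2_dominated:
  assumes f: "f \<in> L2 M" and g: "g \<in> borel_measurable M"
    and le: "\<And>x. x \<in> space M \<Longrightarrow> norm (g x) \<le> C * norm (f x)"
  shows "g \<in> L2 M"
proof -
  have "integrable M (\<lambda>x. (norm (g x))\<^sup>2)"
  proof (rule Bochner_Integration.integrable_bound)
    show "integrable M (\<lambda>x. C\<^sup>2 * (norm (f x))\<^sup>2)"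
      using L2_integrable_square[OF f] by simp
    show "(\<lambda>x. (norm (g x))\<^sup>2) \<in> borel_measurable M" using g by measurable
    show "AE x in M. norm ((norm (g x))\<^sup>2) \<le> norm (C\<^sup>2 * (norm (f x))\<^sup>2)"
      using power_mono[OF le, of _ 2] by (intro AE_I2) (simp add: power_mult_distrib)
  qed
  with g show ?thesis by (simp add: L2_def)
qed

lemma L2_add:
  assumes f: "f \<in> L2 M" and g: "g \<in> L2 M"
  shows "(\<lambda>x. f x + g x) \<in> L2 M"
proof -
  note [measurable] = L2_measurable[OF f] L2_measurable[OF g]
  have "integrable M (\<lambda>x. (norm (f x + g x))\<^sup>2)"
  proof (rule Bochner_Integration.integrable_bound)
    show "integrable M (\<lambda>x. 2 * (norm (f x))\<^sup>2 + 2 * (norm (g x))\<^sup>2)"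
      using L2_integrable_square[OF f] L2_integrable_square[OF g] by simp
    have "(norm (f x + g x))\<^sup>2 \<le> 2 * (norm (f x))\<^sup>2 + 2 * (norm (g x))\<^sup>2" for x
    proof -
      have "(norm (f x + g x))\<^sup>2 \<le> (norm (f x) + norm (g x))\<^sup>2"
        by (intro power_mono norm_triangle_ineq) simp
      also have "\<dots> \<le> 2 * (norm (f x))\<^sup>2 + 2 * (norm (g x))\<^sup>2"
        using sum_squares_bound[of "norm (f x)" "norm (g x)"] by (simp add: power2_sum)
      finally show ?thesis .
    qed
    then show "AE x in M. norm ((norm (f x + g x))\<^sup>2)
        \<le> norm (2 * (norm (f x))\<^sup>2 + 2 * (norm (g x))\<^sup>2)"
      by (intro AE_I2) simp
  qed measurable
  then show ?thesis by (simp add: L2_def)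
qed

lemma L2_zero: "(\<lambda>_. 0) \<in> L2 M"
  by (simp add: L2_def)

lemma L2_sum: "(\<And>i. i \<in> I \<Longrightarrow> f i \<in> L2 M) \<Longrightarrow> (\<lambda>x. \<Sum>i\<in>I. f i x) \<in> L2 M"
  by (induction I rule: infinite_finite_induct) (auto intro: L2_add simp: L2_zero)

lemma L2_mult_integrable:
  fixes f g :: "'a \<Rightarrow> real"
  assumes f: "f \<in> L2 M" and g: "g \<in> L2 M"
  shows "integrable M (\<lambda>x. f x * g x)"
proof (rule Bochner_Integration.integrable_bound)
  note [measurable] = L2_measurable[OF f] L2_measurable[OF g]
  show "(\<lambda>x. f x * g x) \<in> borel_measurable M" by measurable
  show "integrable M (\<lambda>x. (norm (f x))\<^sup>2 + (norm (g x))\<^sup>2)"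
    using L2_integrable_square[OF f] L2_integrable_square[OF g] by simp
  have "\<bar>f x * g x\<bar> \<le> \<bar>f x\<bar>\<^sup>2 + \<bar>g x\<bar>\<^sup>2" for x
    using sum_squares_bound[of "\<bar>f x\<bar>" "\<bar>g x\<bar>"] abs_ge_zero[of "f x * g x"]
    unfolding abs_mult by linarith
  then show "AE x in M. norm (f x * g x) \<le> norm ((norm (f x))\<^sup>2 + (norm (g x))\<^sup>2)"
    by (intro AE_I2) simp
qed

lemma L2_norm_power2: "(L2_norm M f)\<^sup>2 = L2_inner M f f"
  by (simp add: L2_norm_def L2_inner_def)

text \<open>The jump at \<open>x\<close> reads traces at \<open>x - z\<close>; this moves their
  square integrability from the boundary of an element to that of its translate.\<close>

lemma L2_hausdorff_translate:
  assumes "f \<in> L2 (hausdorff m)"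
  shows "(\<lambda>x. f (x - z)) \<in> L2 (hausdorff m)"
proof -
  have f: "f \<in> borel_measurable borel"
    using L2_measurable[OF assms] by measurable
  have "integrable (distr (hausdorff m) borel (\<lambda>x. x - z)) (\<lambda>x. (norm (f x))\<^sup>2)"
    using L2_integrable_square[OF assms] by (simp add: distr_hausdorff_translation)
  then have "integrable (hausdorff m) (\<lambda>x. (norm (f (x - z)))\<^sup>2)"
    by (subst (asm) integrable_distr_eq) (use f in measurable)
  moreover have "(\<lambda>x. f (x - z)) \<in> borel_measurable (hausdorff m)" using f by measurable
  ultimately show ?thesis by (simp add: L2_def)
qed

lemma space_surface [simp]: "space (surface \<kappa>) = frontier \<kappa>"
  by (simp add: surface_def space_restrict_space)

lemma L2_surface_of_hausdorff:
  assumes "f \<in> L2 (hausdorff (CARD('n) - 1))"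
  shows "f \<in> L2 (surface (\<kappa> :: (real^'n) set))"
proof -
  have S: "frontier \<kappa> \<inter> space (hausdorff (CARD('n) - 1)) \<in> sets (hausdorff (CARD('n) - 1))"
    by simp
  have "f \<in> borel_measurable (surface \<kappa>)"
    unfolding surface_def by (rule measurable_restrict_space1[OF L2_measurable[OF assms]])
  moreover have "integrable (surface \<kappa>) (\<lambda>x. (norm (f x))\<^sup>2)"
    unfolding surface_def integrable_restrict_space[OF S]
    using integrable_mult_indicator[OF _ L2_integrable_square[OF assms], of "frontier \<kappa>"] by simp
  ultimately show ?thesis by (simp add: L2_def)
qed

text \<open>Extension by zero puts functions living on the boundaries of different elements into one
  space, where they can be shifted and added.\<close>

lemma L2_hausdorff_of_surface:
  fixes f :: "real^'n \<Rightarrow> 'b::euclidean_space"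
  assumes f: "f \<in> L2 (surface \<kappa>)"
  shows "(\<lambda>x. indicator (frontier \<kappa>) x *\<^sub>R f x) \<in> L2 (hausdorff (CARD('n) - 1))"
proof -
  have S: "frontier \<kappa> \<inter> space (hausdorff (CARD('n) - 1)) \<in> sets (hausdorff (CARD('n) - 1))"
    by simp
  have "(\<lambda>x. indicator (frontier \<kappa>) x *\<^sub>R f x) \<in> borel_measurable (hausdorff (CARD('n) - 1))"
    using L2_measurable[OF f] unfolding surface_def borel_measurable_restrict_space_iff[OF S] .
  moreover have "integrable (hausdorff (CARD('n) - 1)) (\<lambda>x. indicator (frontier \<kappa>) x *\<^sub>R (norm (f x))\<^sup>2)"
    using L2_integrable_square[OF f] unfolding surface_def integrable_restrict_space[OF S] .
  moreover have "(\<lambda>x. indicator (frontier \<kappa>) x *\<^sub>R (norm (f x))\<^sup>2)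
      = (\<lambda>x. (norm (indicator (frontier \<kappa>) x *\<^sub>R f x))\<^sup>2)"
    by (auto simp: fun_eq_iff indicator_def)
  ultimately show ?thesis by (simp add: L2_def)
qed

lemma bdry_trace_L2: "bdry_trace \<kappa> v \<in> L2 (surface \<kappa>)"
proof (cases "\<exists>g. is_trace \<kappa> v g")
  case True
  then have "is_trace \<kappa> v (bdry_trace \<kappa> v)" by (simp add: bdry_trace_def someI_ex)
  then show ?thesis by (simp add: is_trace_def)
qed (simp add: bdry_trace_def L2_zero)

text \<open>This is one summand of the jump as a function on the whole space. The indicator removes
  the points without a normal, and on the rest the normal has length 1, so the trace
  dominates.\<close>

lemma normal_trace_L2:
  fixes \<kappa> :: "(real^'n) set"
  assumes "open \<kappa>"
  shows "(\<lambda>x. indicator (flat_boundary \<kappa>) x *\<^sub>R (bdry_trace \<kappa> v x *\<^sub>R outer_normal \<kappa> x))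
    \<in> L2 (hausdorff (CARD('n) - 1))"
proof (rule L2_dominated[OF L2_hausdorff_of_surface[OF bdry_trace_L2[of \<kappa> v]]])
  have [measurable]: "(\<lambda>x. indicator (frontier \<kappa>) x *\<^sub>R bdry_trace \<kappa> v x) \<in> borel_measurable borel"
    using L2_measurable[OF L2_hausdorff_of_surface[OF bdry_trace_L2[of \<kappa> v]]] by measurable
  note [measurable] = outer_normal_measurable[OF assms] flat_boundary_borel[OF assms]
  \<comment> \<open>The trace is known to be measurable on the frontier only, so the indicator of
    the frontier is inserted; it equals 1 wherever the other indicator does.\<close>
  have "(\<lambda>x. indicator (flat_boundary \<kappa>) x *\<^sub>R (bdry_trace \<kappa> v x *\<^sub>R outer_normal \<kappa> x))
    = (\<lambda>x. indicator (flat_boundary \<kappa>) x *\<^sub>R ((indicator (frontier \<kappa>) x *\<^sub>R bdry_trace \<kappa> v x) *\<^sub>R outer_normal \<kappa> x))"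
    using flat_boundary_subset[OF assms] by (auto simp: fun_eq_iff indicator_def)
  also have "\<dots> \<in> borel_measurable (hausdorff (CARD('n) - 1))" by measurable
  finally show "(\<lambda>x. indicator (flat_boundary \<kappa>) x *\<^sub>R (bdry_trace \<kappa> v x *\<^sub>R outer_normal \<kappa> x))
    \<in> borel_measurable (hausdorff (CARD('n) - 1))" .
  show "norm (indicator (flat_boundary \<kappa>) x *\<^sub>R (bdry_trace \<kappa> v x *\<^sub>R outer_normal \<kappa> x))
       \<le> 1 * norm (indicator (frontier \<kappa>) x *\<^sub>R bdry_trace \<kappa> v x)" for x
    using flat_boundary_subset[OF assms] norm_outer_normal[of x \<kappa>] by (auto simp: indicator_def)
qed

section \<open>Square integrability of jumps and of normal derivatives\<close>

lemma partition_element: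
  assumes "regular_periodic_partition K" "\<kappa> \<in> K"
  shows "open \<kappa>" "\<kappa> \<noteq> {}" "\<kappa> \<subseteq> unit_cube" "finite K"
  using assms by (auto simp: regular_periodic_partition_def polyhedral_element_def)

lemma closure_unit_cube_bounds:
  fixes x :: "real^'n"
  assumes "x \<in> closure unit_cube"
  shows "0 \<le> x $ i \<and> x $ i \<le> 1"
proof -
  have "closed ({x :: real^'n. 0 \<le> x $ i} \<inter> {x. x $ i \<le> 1})"
    by (intro closed_Int closed_Collect_le continuous_intros)
  moreover have "unit_cube \<subseteq> {x :: real^'n. 0 \<le> x $ i} \<inter> {x. x $ i \<le> 1}"
    by (auto simp: unit_cube_def less_imp_le)
  ultimately show ?thesis using assms closure_minimal by blast
qed

text \<open>The shifts that can occur between neighbours. Together with the elements they form a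
  finite index set for \<open>adjacent K x\<close> that does not vary with \<open>x\<close>.\<close>

definition near_lattice :: "(real^'n) set" where
  "near_lattice = {z. \<forall>i. z $ i \<in> {-1, 0, 1}}"

lemma finite_near_lattice: "finite (near_lattice :: (real^'n) set)"
proof -
  have "(near_lattice :: (real^'n) set) \<subseteq> vec_lambda ` (UNIV \<rightarrow>\<^sub>E {-1, 0, 1})"
  proof
    fix z :: "real^'n" assume "z \<in> near_lattice"
    then show "z \<in> vec_lambda ` (UNIV \<rightarrow>\<^sub>E {-1, 0, 1})"
      by (intro image_eqI[of _ _ "vec_nth z"]) (auto simp: near_lattice_def)
  qed
  then show ?thesis by (rule finite_subset) (intro finite_imageI finite_PiE; simp)
qed

text \<open>Both \<open>x\<close> and \<open>x - z\<close> lie in the closed unit cube, so the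
  integer coordinates of \<open>z\<close> have modulus at most 1.\<close>

lemma adjacent_eq:
  fixes x :: "real^'n"
  assumes K: "regular_periodic_partition K" and x: "x \<in> closure unit_cube"
  shows "adjacent K x = {p \<in> K \<times> near_lattice. x - snd p \<in> flat_boundary (fst p)}"
proof (intro set_eqI iffI)
  fix p assume p: "p \<in> adjacent K x"
  then have a: "fst p \<in> K" "snd p \<in> int_lattice" "x - snd p \<in> flat_boundary (fst p)"
    by (auto simp: adjacent_def flat_boundary_def)
  then have "x - snd p \<in> frontier (fst p)"
    using flat_boundary_subset partition_element[OF K] by blast
  then have y: "x - snd p \<in> closure unit_cube"
    using partition_element(3)[OF K a(1)] closure_mono frontier_def by blast
  have "snd p $ i \<in> {-1, 0, 1}" for i
  proof -
    obtain k where k: "snd p $ i = of_int k" using a(2) by (auto simp: int_lattice_def elim: Ints_cases)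
    moreover have "\<bar>snd p $ i\<bar> \<le> 1"
      using closure_unit_cube_bounds[OF x, of i] closure_unit_cube_bounds[OF y, of i] by auto
    ultimately have "\<bar>k\<bar> \<le> 1" by linarith
    then have "k \<in> {-1, 0, 1}" by auto
    with k show ?thesis by auto
  qed
  then show "p \<in> {p \<in> K \<times> near_lattice. x - snd p \<in> flat_boundary (fst p)}"
    using a by (auto simp: near_lattice_def mem_Times_iff)
next
  fix p assume p: "p \<in> {p \<in> K \<times> near_lattice. x - snd p \<in> flat_boundary (fst p)}"
  moreover have "near_lattice \<subseteq> (int_lattice :: (real^'n) set)"
    unfolding near_lattice_def int_lattice_def by auto (metis Ints_0 Ints_1 Ints_minus)
  ultimately show "p \<in> adjacent K x" by (auto simp: adjacent_def flat_boundary_def)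
qed

text \<open>The jump sums over a set that varies with \<open>x\<close> and tests its cardinality.
  Both are rewritten over the fixed finite index set: \<open>S\<close> sums all candidate
  contributions, cut off by indicators, and \<open>c\<close> counts the adjacent sides, so that on
  the frontier the jump is \<open>S\<close> restricted to the Borel set where \<open>c\<close>
  equals 2.\<close>

lemma jump_L2:
  fixes \<kappa> :: "(real^'n) set"
  assumes K: "regular_periodic_partition K" and \<kappa>: "\<kappa> \<in> K"
  shows "jump K v \<in> L2 (surface \<kappa>)"
proof -
  let ?P = "K \<times> (near_lattice :: (real^'n) set)"
  let ?F = "\<lambda>\<kappa> y. indicator (flat_boundary \<kappa>) y *\<^sub>R (bdry_trace \<kappa> v y *\<^sub>R outer_normal \<kappa> y)"
  define S where "S = (\<lambda>x. \<Sum>p\<in>?P. ?F (fst p) (x - snd p))"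
  define c :: "real^'n \<Rightarrow> real" where "c = (\<lambda>x. \<Sum>p\<in>?P. indicator (flat_boundary (fst p)) (x - snd p))"
  have fin: "finite ?P" using partition_element[OF K \<kappa>] finite_near_lattice by blast
  have S: "S \<in> L2 (surface \<kappa>)"
    unfolding S_def
    by (intro L2_surface_of_hausdorff L2_sum L2_hausdorff_translate normal_trace_L2
        partition_element[OF K]) auto
  have "c \<in> borel_measurable borel"
    unfolding c_def
  proof (rule borel_measurable_sum)
    fix p :: "(real^'n) set \<times> (real^'n)" assume "p \<in> ?P"
    then have [measurable]: "flat_boundary (fst p) \<in> sets borel"
      by (intro flat_boundary_borel partition_element(1)[OF K]) auto
    show "(\<lambda>x. indicator (flat_boundary (fst p)) (x - snd p)) \<in> borel_measurable borel"
      by measurable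
  qed
  then have "{x. c x = 2} \<in> sets borel" by measurable
  then have C: "{x. c x = 2} \<inter> frontier \<kappa> \<in> sets (surface \<kappa>)"
    unfolding surface_def sets_restrict_space by (auto simp: Int_commute)
  have c: "c x = real (card (adjacent K x))"
    and J: "jump K v x = (if c x = 2 then S x else 0)" if "x \<in> frontier \<kappa>" for x
  proof -
    have "x \<in> closure unit_cube"
      using that partition_element(3)[OF K \<kappa>] closure_mono frontier_def by blast
    note adj = adjacent_eq[OF K this]
    show c: "c x = real (card (adjacent K x))"
      unfolding c_def adj indicator_def by (subst sum_of_bool_eq) (simp_all add: fin Int_def)
    have "(\<Sum>(\<kappa>, z)\<in>adjacent K x. bdry_trace \<kappa> v (x - z) *\<^sub>R outer_normal \<kappa> (x - z)) = S x"
      unfolding S_def adj using fin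
      by (intro sum.mono_neutral_cong_left) (auto simp: indicator_def)
    then show "jump K v x = (if c x = 2 then S x else 0)" by (simp add: jump_def c)
  qed
  show ?thesis
  proof (rule L2_dominated[OF S])
    have "(\<lambda>x. if x \<in> {x. c x = 2} \<inter> frontier \<kappa> then S x else 0) \<in> borel_measurable (surface \<kappa>)"
      using L2_measurable[OF S] C by (intro measurable_If_set) auto
    also have "?this \<longleftrightarrow> jump K v \<in> borel_measurable (surface \<kappa>)"
      by (rule measurable_cong) (simp add: J)
    finally show "jump K v \<in> borel_measurable (surface \<kappa>)" .
    show "norm (jump K v x) \<le> 1 * norm (S x)" if "x \<in> space (surface \<kappa>)" for x
      using J that by simp
  qed
qed

lemma outer_normal_measurable_surface:
  fixes \<kappa> :: "(real^'n) set"
  assumes "open \<kappa>"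
  shows "outer_normal \<kappa> \<in> borel_measurable (surface \<kappa>)"
proof -
  have "outer_normal \<kappa> \<in> borel_measurable (hausdorff (CARD('n) - 1))"
    using outer_normal_measurable[OF assms] by measurable
  then show ?thesis unfolding surface_def by (rule measurable_restrict_space1)
qed

text \<open>The trace of the gradient is taken componentwise, so each component is multiplied by a
  bounded measurable component of the normal and the products are added.\<close>

lemma grad_trace_normal_L2:
  fixes \<kappa> :: "(real^'n) set"
  assumes "open \<kappa>"
  shows "(\<lambda>x. grad_trace \<kappa> v x \<bullet> outer_normal \<kappa> x) \<in> L2 (surface \<kappa>)"
proof -
  have "(\<lambda>x. \<Sum>i\<in>UNIV. bdry_trace \<kappa> (\<lambda>y. weak_grad \<kappa> v y $ i) x * outer_normal \<kappa> x $ i) \<in> L2 (surface \<kappa>)"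
  proof (rule L2_sum)
    fix i :: 'n
    let ?t = "bdry_trace \<kappa> (\<lambda>y. weak_grad \<kappa> v y $ i)"
    have t: "?t \<in> L2 (surface \<kappa>)" by (rule bdry_trace_L2)
    show "(\<lambda>x. ?t x * outer_normal \<kappa> x $ i) \<in> L2 (surface \<kappa>)"
    proof (rule L2_dominated[OF t])
      have "(\<lambda>x. outer_normal \<kappa> x \<bullet> axis i 1) \<in> borel_measurable (surface \<kappa>)"
        using outer_normal_measurable_surface[OF assms] by measurable
      then have "(\<lambda>x. outer_normal \<kappa> x $ i) \<in> borel_measurable (surface \<kappa>)"
        by (simp add: inner_axis)
      then show "(\<lambda>x. ?t x * outer_normal \<kappa> x $ i) \<in> borel_measurable (surface \<kappa>)"
        using L2_measurable[OF t] by measurable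
      fix x
      \<comment> \<open>The constant also covers the default normal, because the norm in
        \<open>d_const\<close> integrates over the whole frontier.\<close>
      have "norm (outer_normal \<kappa> x) \<le> max 1 (norm (THE n :: real^'n. False))"
        using norm_outer_normal[of x \<kappa>] outer_normal_outside_flat_boundary[of x \<kappa>]
        by (cases "x \<in> flat_boundary \<kappa>") auto
      then have "\<bar>outer_normal \<kappa> x $ i\<bar> \<le> max 1 (norm (THE n :: real^'n. False))"
        using component_le_norm_cart[of "outer_normal \<kappa> x" i] by linarith
      then show "norm (?t x * outer_normal \<kappa> x $ i) \<le> max 1 (norm (THE n :: real^'n. False)) * norm (?t x)"
        by (simp add: abs_mult mult.commute[of "\<bar>?t x\<bar>"] mult_right_mono)
    qed
  qed
  then show ?thesis by (simp add: inner_vec_def grad_trace_def)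
qed


section \<open>Weak gradients and additive constants\<close>

lemma test_fun_partial_deriv:
  assumes "\<phi> \<in> test_fun \<kappa>"
  shows "\<phi> differentiable (at x)" "continuous_on UNIV \<phi>" "continuous_on UNIV (partial_deriv i \<phi>)"
proof -
  have "Ck 0 \<phi>" "Ck (Suc 0) \<phi>" using assms by (auto simp: test_fun_def smooth_def)
  then show "\<phi> differentiable (at x)" "continuous_on UNIV \<phi>" "continuous_on UNIV (partial_deriv i \<phi>)"
    by auto
qed

lemma has_derivative_along_axis:
  assumes "f differentiable (at (x + s *\<^sub>R axis i 1))"
  shows "((\<lambda>t. f (x + t *\<^sub>R axis i 1)) has_real_derivative
      partial_deriv i f (x + s *\<^sub>R axis i 1)) (at s)"
proof -
  let ?y = "x + s *\<^sub>R axis i 1"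
  have D: "(f has_derivative frechet_derivative f (at ?y)) (at ?y)"
    using assms frechet_derivative_works by blast
  have "((\<lambda>t. x + t *\<^sub>R axis i 1) has_derivative (\<lambda>t. t *\<^sub>R axis i 1)) (at s)"
    by (auto intro!: derivative_eq_intros)
  from has_derivative_compose[OF this D]
  have "((\<lambda>t. f (x + t *\<^sub>R axis i 1)) has_derivative
      (\<lambda>t. frechet_derivative f (at ?y) (t *\<^sub>R axis i 1))) (at s)" .
  moreover have "frechet_derivative f (at ?y) (t *\<^sub>R axis i 1) = t *\<^sub>R partial_deriv i f ?y" for t
    unfolding partial_deriv_def
    by (rule linear_cmul[OF has_derivative_linear[OF D]])
  ultimately show ?thesis
    unfolding has_field_derivative_def by (simp add: mult.commute[of _ "partial_deriv i f ?y"])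
qed

lemma partial_deriv_test_fun_support:
  assumes \<phi>: "\<forall>x. x \<notin> C \<longrightarrow> \<phi> x = 0" and "closed C" and "x \<notin> C"
  shows "partial_deriv i \<phi> x = 0"
proof -
  have "(\<phi> has_derivative (\<lambda>_. 0)) (at x)"
  proof (rule has_derivative_transform_within_open[of "\<lambda>_. 0" _ _ _ "- C"])
    show "open (- C)" using assms(2) by auto
  qed (use assms in auto)
  then have "frechet_derivative \<phi> (at x) = (\<lambda>_. 0)"
    by (metis frechet_derivative_at)
  then show ?thesis by (simp add: partial_deriv_def)
qed

lemma test_fun_partial_deriv_bounded:
  assumes "\<phi> \<in> test_fun \<kappa>"
  obtains M where "\<And>x. \<bar>partial_deriv i \<phi> x\<bar> \<le> M"
proof -
  obtain C where C: "compact C" "\<forall>x. x \<notin> C \<longrightarrow> \<phi> x = 0"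
    using assms unfolding test_fun_def by blast
  have "compact (partial_deriv i \<phi> ` C)"
    using C(1) test_fun_partial_deriv(3)[OF assms] compact_continuous_image continuous_on_subset
    by blast
  then obtain M where M: "\<forall>y\<in>partial_deriv i \<phi> ` C. norm y \<le> M"
    using compact_imp_bounded bounded_iff by blast
  have "\<bar>partial_deriv i \<phi> x\<bar> \<le> max M 0" for x
    using M partial_deriv_test_fun_support[OF C(2) compact_imp_closed[OF C(1)], of x i]
    by (cases "x \<in> C") auto
  then show thesis by (rule that)
qed

text \<open>The difference quotients of \<open>\<phi>\<close> have integral zero by translation invariance.\<close>

lemma integral_partial_deriv_eq_0:
  fixes \<phi> :: "real^'n \<Rightarrow> real"
  assumes \<phi>: "\<phi> \<in> test_fun \<kappa>"
  shows "(\<integral>x. partial_deriv i \<phi> x \<partial>lborel) = 0"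
proof -
  obtain C where C: "compact C" "\<forall>x. x \<notin> C \<longrightarrow> \<phi> x = 0"
    using \<phi> unfolding test_fun_def by blast
  obtain M where M: "\<And>x. \<bar>partial_deriv i \<phi> x\<bar> \<le> M"
    by (fact test_fun_partial_deriv_bounded[OF \<phi>, of i])
  obtain R where "C \<subseteq> ball 0 R" using bounded_subset_ballD[OF compact_imp_bounded[OF C(1)]] by blast
  then have R: "C \<subseteq> cball 0 R" using ball_subset_cball by blast
  define e :: "real^'n" where "e = axis i 1"
  define h :: "nat \<Rightarrow> real" where "h k = inverse (real (Suc k))" for k
  have h: "h k > 0" "h k \<le> 1" for k by (auto simp: h_def inverse_le_1_iff)
  have h0: "h \<longlonglongrightarrow> 0" unfolding h_def by (rule LIMSEQ_inverse_real_of_nat)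
  define q where "q k x = (\<phi> (x + h k *\<^sub>R e) - \<phi> x) / h k" for k x
  have meas [measurable]: "\<phi> \<in> borel_measurable borel" "partial_deriv i \<phi> \<in> borel_measurable borel"
    by (rule borel_measurable_continuous_onI test_fun_partial_deriv(2,3)[OF \<phi>])+
  have int\<phi>: "integrable lborel \<phi>"
  proof -
    have "integrable lborel (\<lambda>x. indicator C x *\<^sub>R \<phi> x)"
      using C(1) test_fun_partial_deriv(2)[OF \<phi>] continuous_on_subset
      by (intro borel_integrable_compact) auto
    also have "(\<lambda>x. indicator C x *\<^sub>R \<phi> x) = \<phi>" using C(2) by (auto simp: indicator_def fun_eq_iff)
    finally show ?thesis .
  qed
  have trans: "integrable lborel (\<lambda>x. \<phi> (x + c))" "(\<integral>x. \<phi> (x + c) \<partial>lborel) = (\<integral>x. \<phi> x \<partial>lborel)" for c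
  proof -
    have "integrable (distr lborel borel ((+) c)) \<phi>" using int\<phi> by (simp add: lborel_distr_plus)
    then show "integrable lborel (\<lambda>x. \<phi> (x + c))"
      by (subst (asm) integrable_distr_eq) (auto simp: add.commute)
    have "(\<integral>x. \<phi> x \<partial>lborel) = (\<integral>x. \<phi> x \<partial>(distr lborel borel ((+) c)))" by (simp add: lborel_distr_plus)
    also have "\<dots> = (\<integral>x. \<phi> (x + c) \<partial>lborel)" by (subst integral_distr) (auto simp: add.commute)
    finally show "(\<integral>x. \<phi> (x + c) \<partial>lborel) = (\<integral>x. \<phi> x \<partial>lborel)" by simp
  qed
  have q0: "(\<integral>x. q k x \<partial>lborel) = 0" for k
    unfolding q_def using trans[of "h k *\<^sub>R e"] int\<phi> by simp
  have "(\<lambda>k. \<integral>x. q k x \<partial>lborel) \<longlonglongrightarrow> (\<integral>x. partial_deriv i \<phi> x \<partial>lborel)"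
  proof (rule integral_dominated_convergence)
    \<comment> \<open>By the mean value theorem each difference quotient is a value of the partial
      derivative, hence at most \<open>M\<close>. Steps of length at most 1 enlarge the support by
      at most 1, which explains the radius \<open>R + 1\<close>.\<close>
    show "integrable lborel (\<lambda>x. indicator (cball (0::real^'n) (R + 1)) x *\<^sub>R M)"
      by (intro borel_integrable_compact) auto
    show "q k \<in> borel_measurable lborel" for k unfolding q_def by measurable
    show "AE x in lborel. (\<lambda>k. q k x) \<longlonglongrightarrow> partial_deriv i \<phi> x"
    proof (rule AE_I2)
      fix x
      have "((\<lambda>t. \<phi> (x + t *\<^sub>R e)) has_real_derivative partial_deriv i \<phi> (x + 0 *\<^sub>R e)) (at 0)"
        unfolding e_def by (intro has_derivative_along_axis test_fun_partial_deriv(1)[OF \<phi>])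
      then have "((\<lambda>t. (\<phi> (x + t *\<^sub>R e) - \<phi> x) / t) \<longlongrightarrow> partial_deriv i \<phi> x) (at 0)"
        by (simp add: has_field_derivative_iff)
      moreover have "filterlim h (at 0) sequentially"
        using h0 h(1) by (auto simp: filterlim_at less_imp_neq[THEN not_sym])
      ultimately show "(\<lambda>k. q k x) \<longlonglongrightarrow> partial_deriv i \<phi> x"
        unfolding q_def by (rule filterlim_compose)
    qed
    show "AE x in lborel. norm (q k x) \<le> indicator (cball 0 (R + 1)) x *\<^sub>R M" for k
    proof (rule AE_I2)
      fix x
      have "M \<ge> 0" using M[of x] by linarith
      show "norm (q k x) \<le> indicator (cball 0 (R + 1)) x *\<^sub>R M"
      proof (cases "x \<in> cball 0 (R + 1)")
        case True
        have "\<exists>s>0. s < h k \<and> \<phi> (x + h k *\<^sub>R e) - \<phi> (x + 0 *\<^sub>R e) = (h k - 0) * partial_deriv i \<phi> (x + s *\<^sub>R e)"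
          unfolding e_def
          by (rule MVT2[OF h(1)]) (intro has_derivative_along_axis test_fun_partial_deriv(1)[OF \<phi>])
        then obtain s where "\<phi> (x + h k *\<^sub>R e) - \<phi> x = h k * partial_deriv i \<phi> (x + s *\<^sub>R e)"
          by auto
        then have "q k x = partial_deriv i \<phi> (x + s *\<^sub>R e)" using h(1)[of k] by (simp add: q_def)
        then show ?thesis using True M by simp
      next
        case False
        have "norm (h k *\<^sub>R e) \<le> 1" using h[of k] by (simp add: e_def)
        then have "norm x \<le> norm (x + h k *\<^sub>R e) + 1"
          using norm_triangle_ineq4[of "x + h k *\<^sub>R e" "h k *\<^sub>R e"] by simp
        then have "x \<notin> C" "x + h k *\<^sub>R e \<notin> C" using R False by auto
        then show ?thesis using C(2) \<open>M \<ge> 0\<close> by (simp add: q_def)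
      qed
    qed
  qed (measurable; simp)
  then show ?thesis unfolding q0 using LIMSEQ_unique tendsto_const by blast
qed

lemma integral_lebesgue_on_partial_deriv_eq_0:
  fixes \<kappa> :: "(real^'n) set"
  assumes "open \<kappa>" "\<phi> \<in> test_fun \<kappa>"
  shows "(\<integral>x. partial_deriv i \<phi> x \<partial>lebesgue_on \<kappa>) = 0"
proof -
  obtain C where C: "compact C" "C \<subseteq> \<kappa>" "\<forall>x. x \<notin> C \<longrightarrow> \<phi> x = 0"
    using assms(2) unfolding test_fun_def by blast
  have "(\<integral>x. partial_deriv i \<phi> x \<partial>lebesgue_on \<kappa>)
      = (\<integral>x. indicator \<kappa> x *\<^sub>R partial_deriv i \<phi> x \<partial>lebesgue)"
    using assms(1) by (intro integral_restrict_space) auto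
  also have "(\<lambda>x. indicator \<kappa> x *\<^sub>R partial_deriv i \<phi> x) = partial_deriv i \<phi>"
    using C(2) partial_deriv_test_fun_support[OF C(3) compact_imp_closed[OF C(1)], of _ i]
    by (fastforce simp: indicator_def fun_eq_iff)
  also have "(\<integral>x. partial_deriv i \<phi> x \<partial>lebesgue) = (\<integral>x. partial_deriv i \<phi> x \<partial>lborel)"
    using test_fun_partial_deriv(3)[OF assms(2), of i]
    by (intro integral_completion) (auto intro: borel_measurable_continuous_onI)
  also have "\<dots> = 0" by (rule integral_partial_deriv_eq_0[OF assms(2)])
  finally show ?thesis .
qed

section \<open>Effect of additive constants and of null sets on gradient and mean value\<close>

lemma finite_measure_lebesgue_on_open:
  assumes "open \<kappa>" "bounded \<kappa>"
  shows "finite_measure (lebesgue_on \<kappa>)"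
  using assms by (simp add: finite_measure_lebesgue_on lmeasurable_open)

lemma L2_finite_measure_const:
  "finite_measure M \<Longrightarrow> (\<lambda>_. c) \<in> L2 M"
  by (simp add: L2_def finite_measure.integrable_const)

text \<open>The constant contributes \<open>c\<close> times the integral of a partial derivative of
  a test function, which is 0. Splitting the integral needs integrability of both parts; it holds
  because the derivative is bounded and \<kappa> has finite measure.\<close>

lemma is_weak_grad_add_const:
  fixes u :: "real^'n \<Rightarrow> real"
  assumes \<kappa>: "open \<kappa>" "bounded \<kappa>" and u: "u \<in> L2 (lebesgue_on \<kappa>)"
  shows "is_weak_grad \<kappa> (\<lambda>x. u x + c) = is_weak_grad \<kappa> u"
proof -
  have "(\<integral>x. (u x + c) * partial_deriv i \<phi> x \<partial>lebesgue_on \<kappa>)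
      = (\<integral>x. u x * partial_deriv i \<phi> x \<partial>lebesgue_on \<kappa>)" if \<phi>: "\<phi> \<in> test_fun \<kappa>" for \<phi> i
  proof -
    let ?D = "partial_deriv i \<phi>"
    obtain M where M: "\<And>x. \<bar>?D x\<bar> \<le> M"
      by (fact test_fun_partial_deriv_bounded[OF \<phi>, of i])
    have "?D \<in> borel_measurable borel"
      by (rule borel_measurable_continuous_onI[OF test_fun_partial_deriv(3)[OF \<phi>]])
    then have D: "?D \<in> borel_measurable (lebesgue_on \<kappa>)"
      by (intro measurable_restrict_space1 measurable_completion) simp
    have D2: "?D \<in> L2 (lebesgue_on \<kappa>)"
      by (rule L2_dominated[OF L2_finite_measure_const[OF finite_measure_lebesgue_on_open[OF \<kappa>], of M] D, of 1])
        (use M in \<open>simp add: order_trans[OF M abs_ge_self]\<close>)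
    have int: "integrable (lebesgue_on \<kappa>) (\<lambda>x. u x * ?D x)" "integrable (lebesgue_on \<kappa>) (\<lambda>x. c * ?D x)"
      using L2_mult_integrable[OF u D2]
        L2_mult_integrable[OF L2_finite_measure_const[OF finite_measure_lebesgue_on_open[OF \<kappa>]] D2] by auto
    have "(\<integral>x. (u x + c) * ?D x \<partial>lebesgue_on \<kappa>)
        = (\<integral>x. u x * ?D x \<partial>lebesgue_on \<kappa>) + (\<integral>x. c * ?D x \<partial>lebesgue_on \<kappa>)"
      using int by (simp add: distrib_right)
    then show ?thesis
      using integral_lebesgue_on_partial_deriv_eq_0[OF \<kappa>(1) \<phi>, of i] by simp
  qed
  then show ?thesis by (simp add: is_weak_grad_def fun_eq_iff)
qed

text \<open>Equal predicates make \<open>SOME\<close> pick the same representative, so the gradients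
  are equal as functions and so are their traces.\<close>

lemma weak_grad_add_const:
  fixes u :: "real^'n \<Rightarrow> real"
  assumes "open \<kappa>" "bounded \<kappa>" "u \<in> L2 (lebesgue_on \<kappa>)"
  shows "weak_grad \<kappa> (\<lambda>x. u x + c) = weak_grad \<kappa> u"
  using is_weak_grad_add_const[OF assms] by (simp add: weak_grad_def)

text \<open>Holds by completeness of Lebesgue measure. Members of \<open>dg_space\<close> agree with
  local functions only almost everywhere, and their measurability has to be derived from
  this.\<close>

lemma borel_measurable_lebesgue_on_AE:
  fixes f g :: "'a::euclidean_space \<Rightarrow> 'b::euclidean_space"
  assumes S: "S \<in> sets lebesgue" and f: "f \<in> borel_measurable (lebesgue_on S)"
    and ae: "AE x in lebesgue_on S. f x = g x"
  shows "g \<in> borel_measurable (lebesgue_on S)"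
proof -
  have "AE x in lebesgue. x \<in> S \<longrightarrow> f x = g x"
    using ae S by (simp add: AE_restrict_space_iff)
  then have "AE x in lebesgue. (if x \<in> S then f x else 0) = (if x \<in> S then g x else 0)"
    by eventually_elim auto
  from borel_measurable_AE[OF borel_measurable_if_I[OF f S] this]
  show ?thesis by (rule borel_measurable_if_D)
qed

lemma weak_grad_cong_AE:
  fixes u v :: "real^'n \<Rightarrow> real"
  assumes \<kappa>: "open \<kappa>" and u: "u \<in> borel_measurable (lebesgue_on \<kappa>)"
    and ae: "AE x in lebesgue_on \<kappa>. v x = u x"
  shows "weak_grad \<kappa> v = weak_grad \<kappa> u"
proof -
  have v: "v \<in> borel_measurable (lebesgue_on \<kappa>)"
    by (rule borel_measurable_lebesgue_on_AE[OF _ u]) (use \<kappa> ae in auto)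
  have "(\<integral>x. v x * partial_deriv i \<phi> x \<partial>lebesgue_on \<kappa>)
      = (\<integral>x. u x * partial_deriv i \<phi> x \<partial>lebesgue_on \<kappa>)" if \<phi>: "\<phi> \<in> test_fun \<kappa>" for \<phi> i
  proof (rule integral_cong_AE)
    have "partial_deriv i \<phi> \<in> borel_measurable borel"
      by (rule borel_measurable_continuous_onI[OF test_fun_partial_deriv(3)[OF \<phi>]])
    then have [measurable]: "partial_deriv i \<phi> \<in> borel_measurable (lebesgue_on \<kappa>)"
      by (intro measurable_restrict_space1 measurable_completion) simp
    show "(\<lambda>x. v x * partial_deriv i \<phi> x) \<in> borel_measurable (lebesgue_on \<kappa>)"
      "(\<lambda>x. u x * partial_deriv i \<phi> x) \<in> borel_measurable (lebesgue_on \<kappa>)"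
      using u v by measurable
    show "AE x in lebesgue_on \<kappa>. v x * partial_deriv i \<phi> x = u x * partial_deriv i \<phi> x"
      using ae by eventually_elim simp
  qed
  then have "is_weak_grad \<kappa> v = is_weak_grad \<kappa> u" by (simp add: is_weak_grad_def fun_eq_iff)
  then show ?thesis by (simp add: weak_grad_def)
qed

lemma mean_value_add_const:
  fixes u :: "real^'n \<Rightarrow> real"
  assumes \<kappa>: "open \<kappa>" "bounded \<kappa>" and m: "measure lebesgue \<kappa> > 0" and u: "u \<in> L2 (lebesgue_on \<kappa>)"
  shows "mean_value \<kappa> (\<lambda>x. u x + c) = mean_value \<kappa> u + c"
proof -
  note fm = finite_measure_lebesgue_on_open[OF \<kappa>]
  have "integrable (lebesgue_on \<kappa>) u" "integrable (lebesgue_on \<kappa>) (\<lambda>_. c)"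
    using L2_mult_integrable[OF u L2_finite_measure_const[OF fm, of 1]]
    by (simp_all add: finite_measure.integrable_const[OF fm])
  then have "(\<integral>x. u x + c \<partial>lebesgue_on \<kappa>) = (\<integral>x. u x \<partial>lebesgue_on \<kappa>) + c * measure lebesgue \<kappa>"
    using \<kappa>(1) by (simp add: measure_restrict_space)
  then show ?thesis using m by (simp add: mean_value_def field_simps)
qed

lemma star_norm_power2:
  assumes "open \<kappa>"
  shows "(star_norm \<kappa> v)\<^sup>2 = (mean_value \<kappa> v)\<^sup>2 * measure lebesgue \<kappa>
    + (L2_norm (lebesgue_on \<kappa>) (weak_grad \<kappa> v))\<^sup>2"
proof -
  have "(L2_norm (lebesgue_on \<kappa>) (\<lambda>_. mean_value \<kappa> v))\<^sup>2 = (mean_value \<kappa> v)\<^sup>2 * measure lebesgue \<kappa>"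
    using assms unfolding L2_norm_power2
    by (simp add: L2_inner_def measure_restrict_space power2_eq_square)
  then show ?thesis by (simp add: star_norm_def)
qed

text \<open>Adding constants to \<open>u\<close> changes neither the gradient nor its trace, so the supremum may be
  tested with functions of arbitrarily small nonzero mean. This covers constant functions too,
  for which the trace of the gradient need not be known to vanish.\<close>

lemma normal_flux_bound:
  fixes \<kappa> :: "(real^'n) set"
  assumes \<kappa>: "open \<kappa>" "bounded \<kappa>" "\<kappa> \<noteq> {}" and W: "local_space \<kappa> W" and u: "u \<in> W"
    and d: "d_const \<kappa> W \<le> ereal d"
  shows "(L2_norm (surface \<kappa>) (\<lambda>x. grad_trace \<kappa> u x \<bullet> outer_normal \<kappa> x))\<^sup>2
    \<le> d\<^sup>2 * (L2_norm (lebesgue_on \<kappa>) (weak_grad \<kappa> u))\<^sup>2"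
proof -
  let ?L = "L2_norm (surface \<kappa>) (\<lambda>x. grad_trace \<kappa> u x \<bullet> outer_normal \<kappa> x)"
  let ?X = "(L2_norm (lebesgue_on \<kappa>) (weak_grad \<kappa> u))\<^sup>2"
  let ?m = "measure lebesgue \<kappa>"
  have W2: "w \<in> L2 (lebesgue_on \<kappa>)" if "w \<in> W" for w
    using that W by (auto simp: local_space_def H2_def H1_def)
  have m: "?m > 0"
  proof -
    have "\<kappa> \<in> lmeasurable" using \<kappa> by (simp add: lmeasurable_open)
    moreover have "\<not> negligible \<kappa>" using \<kappa> open_not_negligible by blast
    ultimately show ?thesis
      using negligible_iff_measure zero_less_measure_iff by blast
  qed
  \<comment> \<open>The shifted function has mean value \<open>e\<close>, which makes its star norm
    positive. With a zero denominator the quotient in \<open>d_const\<close> would be 0 and bound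
    nothing.\<close>
  have bound: "?L\<^sup>2 \<le> d\<^sup>2 * (e\<^sup>2 * ?m + ?X)"
    if e: "e \<noteq> 0" and nz: "\<not> (AE x in lebesgue_on \<kappa>. u x + (e - mean_value \<kappa> u) = 0)" for e
  proof -
    define w where "w = (\<lambda>x. u x + (e - mean_value \<kappa> u))"
    have w: "w \<in> W" "\<not> (AE x in lebesgue_on \<kappa>. w x = 0)"
      using W u nz unfolding local_space_def w_def by auto
    have g: "weak_grad \<kappa> w = weak_grad \<kappa> u"
      unfolding w_def by (rule weak_grad_add_const[OF \<kappa>(1,2) W2[OF u]])
    then have t: "grad_trace \<kappa> w = grad_trace \<kappa> u" by (simp add: grad_trace_def fun_eq_iff)
    have "mean_value \<kappa> w = e"
      unfolding w_def using mean_value_add_const[OF \<kappa>(1,2) m W2[OF u]] by simp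
    then have star: "(star_norm \<kappa> w)\<^sup>2 = e\<^sup>2 * ?m + ?X" by (simp add: star_norm_power2[OF \<kappa>(1)] g)
    moreover have "e\<^sup>2 * ?m + ?X > 0" using e m by (simp add: add_pos_nonneg)
    moreover have "star_norm \<kappa> w \<ge> 0" by (simp add: star_norm_def)
    ultimately have pos: "star_norm \<kappa> w > 0" by (metis less_eq_real_def power_zero_numeral less_irrefl)
    have "ereal (L2_norm (surface \<kappa>) (\<lambda>x. grad_trace \<kappa> w x \<bullet> outer_normal \<kappa> x) / star_norm \<kappa> w)
        \<le> d_const \<kappa> W"
      unfolding d_const_def using w by (intro SUP_upper) simp
    also note d
    finally have "?L \<le> d * star_norm \<kappa> w" using pos by (simp add: t divide_le_eq)
    moreover have "?L \<ge> 0" by (simp add: L2_norm_def L2_inner_def)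
    ultimately have "?L\<^sup>2 \<le> (d * star_norm \<kappa> w)\<^sup>2" by (intro power_mono)
    then show ?thesis by (simp add: power_mult_distrib star)
  qed
  \<comment> \<open>Functions vanishing almost everywhere are excluded from the supremum. At most
    one shift produces such a function, as two would differ by a nonzero constant that vanishes
    almost everywhere on a set of positive measure; this single value \<open>e0\<close> is avoided
    when \<open>e\<close> tends to 0.\<close>
  have unique: "e = e'"
    if "AE x in lebesgue_on \<kappa>. u x + (e - mean_value \<kappa> u) = 0"
      "AE x in lebesgue_on \<kappa>. u x + (e' - mean_value \<kappa> u) = 0" for e e'
  proof (rule ccontr)
    assume "e \<noteq> e'"
    from that have "AE x in lebesgue_on \<kappa>. False"
      by eventually_elim (use \<open>e \<noteq> e'\<close> in simp)
    then have "AE x in lebesgue. x \<notin> \<kappa>" using \<kappa>(1) by (simp add: AE_restrict_space_iff)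
    then have "\<kappa> \<in> null_sets lebesgue"
      using \<kappa>(1) by (subst AE_iff_null_sets) auto
    then show False using m measure_eq_0_null_sets by (metis less_irrefl)
  qed
  obtain e0 where e0: "\<And>e. e \<noteq> e0 \<Longrightarrow> \<not> (AE x in lebesgue_on \<kappa>. u x + (e - mean_value \<kappa> u) = 0)"
    using unique by metis
  show ?thesis
  proof (rule tendsto_lowerbound)
    have "((\<lambda>e. d\<^sup>2 * (e\<^sup>2 * ?m + ?X)) \<longlongrightarrow> d\<^sup>2 * (0\<^sup>2 * ?m + ?X)) (at 0)"
      by (intro tendsto_intros)
    then show "((\<lambda>e. d\<^sup>2 * (e\<^sup>2 * ?m + ?X)) \<longlongrightarrow> d\<^sup>2 * ?X) (at 0)" by simp
    show "\<forall>\<^sub>F e in at 0. ?L\<^sup>2 \<le> d\<^sup>2 * (e\<^sup>2 * ?m + ?X)"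
      using eventually_neq_at_within[of e0 "0::real" UNIV] eventually_neq_at_within[of 0 "0::real" UNIV]
      by eventually_elim (rule bound[OF _ e0])
  qed simp
qed


section \<open>Coercivity\<close>

lemma bounded_unit_cube: "bounded (unit_cube :: (real^'n) set)"
proof (rule bounded_subset)
  show "unit_cube \<subseteq> cbox (0 :: real^'n) 1"
    by (auto simp: unit_cube_def mem_box_cart less_imp_le)
qed simp

text \<open>Young's inequality is used in the form \<open>0 \<le> ((1 + \<theta>) * f x - \<gamma> *
  s)\<^sup>2 / (4 * \<gamma>)\<close>, where \<open>s\<close> is the signed length of the jump along
  the normal. This fixes the weight \<open>c\<close>, and the lower bound on \<gamma> says that
  \<open>c * d\<^sup>2\<close> is at most 1/2.\<close>

lemma flux_term_bound:
  fixes \<kappa> :: "(real^'n) set"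
  assumes K: "regular_periodic_partition K" and \<kappa>: "\<kappa> \<in> K" and W: "local_space \<kappa> W"
    and \<gamma>: "\<gamma> > 0" "ereal \<gamma> \<ge> ereal (1/2 * (1 + \<theta>)\<^sup>2) * (d_const \<kappa> W)\<^sup>2"
    and u: "u \<in> W" "AE x in lebesgue_on \<kappa>. v x = u x"
  shows "(1 + \<theta>) / 2 * L2_inner (surface \<kappa>) (grad_trace \<kappa> v) (jump K v)
    \<le> 1/2 * (L2_norm (lebesgue_on \<kappa>) (weak_grad \<kappa> v))\<^sup>2
      + \<gamma> / 4 * (L2_norm (surface \<kappa>) (jump K v))\<^sup>2"
\<comment> \<open>For this value the hypothesis degenerates to
  \<open>0 * (d_const \<kappa> W)\<^sup>2\<close>, which is 0 in \<open>ereal\<close> even for an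
  infinite constant and so carries no information, but the flux term vanishes as well.\<close>
proof (cases "\<theta> = - 1")
  case True
  then show ?thesis using \<gamma> by simp
next
  case False
  let ?S = "surface \<kappa>"
  let ?X = "(L2_norm (lebesgue_on \<kappa>) (weak_grad \<kappa> v))\<^sup>2"
  define f where "f = (\<lambda>x. grad_trace \<kappa> v x \<bullet> outer_normal \<kappa> x)"
  define g where "g = jump K v"
  define c where "c = (1 + \<theta>)\<^sup>2 / (4 * \<gamma>)"
  have \<kappa>': "open \<kappa>" "bounded \<kappa>" "\<kappa> \<noteq> {}"
    using partition_element[OF K \<kappa>] bounded_subset[OF bounded_unit_cube] by auto
  define a where "a = 1/2 * (1 + \<theta>)\<^sup>2"
  have "a > 0" using False by (simp add: a_def add_eq_0_iff)
  moreover have "ereal a * (d_const \<kappa> W)\<^sup>2 \<le> ereal \<gamma>" using \<gamma>(2) by (simp only: a_def)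
  \<comment> \<open>Either infinite value has square \<infinity>, and times the positive number
    \<open>a\<close> this would exceed the real number \<gamma>; so finiteness follows from the
    hypothesis itself.\<close>
  ultimately obtain d where d: "d_const \<kappa> W = ereal d"
    by (cases "d_const \<kappa> W") (auto simp: power2_eq_square)
  have d\<gamma>: "(1 + \<theta>)\<^sup>2 * d\<^sup>2 \<le> 2 * \<gamma>" using \<gamma>(2) by (simp add: d)
  have "weak_grad \<kappa> v = weak_grad \<kappa> u"
    using W u by (intro weak_grad_cong_AE[OF \<kappa>'(1)]) (auto simp: local_space_def H2_def H1_def L2_def)
  then have flux: "(L2_norm ?S f)\<^sup>2 \<le> d\<^sup>2 * ?X"
    using normal_flux_bound[OF \<kappa>' W u(1), of d] by (simp add: d f_def grad_trace_def)
  have f: "f \<in> L2 ?S" unfolding f_def by (rule grad_trace_normal_L2[OF \<kappa>'(1)])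
  have g: "g \<in> L2 ?S" unfolding g_def by (rule jump_L2[OF K \<kappa>])
  have young: "(1 + \<theta>) / 2 * (grad_trace \<kappa> v x \<bullet> g x) \<le> c * (f x * f x) + \<gamma> / 4 * (g x \<bullet> g x)"
    if x: "x \<in> frontier \<kappa>" for x
  proof (cases "g x = 0")
    case True
    then show ?thesis using \<gamma>(1) by (simp add: c_def)
  next
    case False
    then have flat: "x \<in> flat_boundary \<kappa>" and "\<exists>s. g x = s *\<^sub>R outer_normal \<kappa> x"
      using jump_parallel_outer_normal[OF K \<kappa> x] by (auto simp: g_def)
    then obtain s where s: "g x = s *\<^sub>R outer_normal \<kappa> x" by blast
    have "g x \<bullet> g x = s\<^sup>2" using norm_outer_normal[OF flat] by (simp add: s dot_square_norm power2_eq_square)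
    moreover have "grad_trace \<kappa> v x \<bullet> g x = s * f x" by (simp add: s f_def)
    moreover have "(1 + \<theta>) / 2 * (s * f x) \<le> c * (f x * f x) + \<gamma> / 4 * s\<^sup>2"
    proof -
      have "0 \<le> ((1 + \<theta>) * f x - \<gamma> * s)\<^sup>2 / (4 * \<gamma>)" using \<gamma>(1) by simp
      also have "\<dots> = c * (f x * f x) + \<gamma> / 4 * s\<^sup>2 - (1 + \<theta>) / 2 * (s * f x)"
        using \<gamma>(1) by (simp add: c_def power2_eq_square field_simps)
      finally show ?thesis by simp
    qed
    ultimately show ?thesis by simp
  qed
  \<comment> \<open>Writing the flux integrand as a product of two scalar square integrable
    functions, the normal derivative and the normal component of the jump, yields its
    integrability.\<close>
  have "grad_trace \<kappa> v x \<bullet> g x = f x * (g x \<bullet> outer_normal \<kappa> x)" if x: "x \<in> frontier \<kappa>" for x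
  proof (cases "g x = 0")
    case False
    then obtain s where "g x = s *\<^sub>R outer_normal \<kappa> x" "x \<in> flat_boundary \<kappa>"
      using jump_parallel_outer_normal[OF K \<kappa> x] by (auto simp: g_def)
    then show ?thesis using norm_outer_normal[of x \<kappa>] by (simp add: f_def dot_square_norm)
  qed simp
  note inner = this
  have n: "(\<lambda>x. g x \<bullet> outer_normal \<kappa> x) \<in> L2 ?S"
  proof (rule L2_dominated[OF g])
    have "outer_normal \<kappa> \<in> borel_measurable ?S" by (rule outer_normal_measurable_surface[OF \<kappa>'(1)])
    then show "(\<lambda>x. g x \<bullet> outer_normal \<kappa> x) \<in> borel_measurable ?S"
      using L2_measurable[OF g] by measurable
    show "norm (g x \<bullet> outer_normal \<kappa> x) \<le> 1 * norm (g x)" if "x \<in> space ?S" for x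
    proof (cases "g x = 0")
      case False
      then have "x \<in> flat_boundary \<kappa>"
        using jump_parallel_outer_normal[OF K \<kappa>] that by (auto simp: g_def)
      then show ?thesis
        using Cauchy_Schwarz_ineq2[of "g x" "outer_normal \<kappa> x"] norm_outer_normal[of x \<kappa>] by simp
    qed simp
  qed
  have "integrable ?S (\<lambda>x. grad_trace \<kappa> v x \<bullet> g x)"
    using L2_mult_integrable[OF f n] by (rule Bochner_Integration.integrable_cong[THEN iffD1, rotated -1])
      (simp_all add: inner)
  then have "(1 + \<theta>) / 2 * L2_inner ?S (grad_trace \<kappa> v) g = (\<integral>x. (1 + \<theta>) / 2 * (grad_trace \<kappa> v x \<bullet> g x) \<partial>?S)"
    "integrable ?S (\<lambda>x. (1 + \<theta>) / 2 * (grad_trace \<kappa> v x \<bullet> g x))"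
    by (simp_all add: L2_inner_def)
  note lhs = this
  have ig: "integrable ?S (\<lambda>x. g x \<bullet> g x)" and "integrable ?S (\<lambda>x. f x * f x)"
    using L2_integrable_square[OF g] L2_mult_integrable[OF f f] by (simp_all add: dot_square_norm)
  note int = this
  have "(\<integral>x. (1 + \<theta>) / 2 * (grad_trace \<kappa> v x \<bullet> g x) \<partial>?S)
      \<le> (\<integral>x. c * (f x * f x) + \<gamma> / 4 * (g x \<bullet> g x) \<partial>?S)"
    using lhs(2) int young by (intro integral_mono) auto
  also have "\<dots> = c * (L2_norm ?S f)\<^sup>2 + \<gamma> / 4 * (L2_norm ?S g)\<^sup>2"
    using int by (simp add: L2_norm_power2 L2_inner_def)
  also have "\<dots> \<le> 1/2 * ?X + \<gamma> / 4 * (L2_norm ?S g)\<^sup>2"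
  proof -
    have "c * (L2_norm ?S f)\<^sup>2 \<le> c * (d\<^sup>2 * ?X)"
      using flux \<gamma>(1) by (intro mult_left_mono) (auto simp: c_def)
    also have "\<dots> = (1 + \<theta>)\<^sup>2 * d\<^sup>2 / (4 * \<gamma>) * ?X" by (simp add: c_def)
    also have "\<dots> \<le> 1/2 * ?X"
      using d\<gamma> \<gamma>(1) by (intro mult_right_mono) (auto simp: divide_le_eq mult.commute)
    finally show ?thesis by simp
  qed
  finally show ?thesis unfolding g_def[symmetric] lhs(1) .
qed

theorem lemma3p1:
  fixes K :: "(real^'n) set set"
    and V :: "(real^'n) set \<Rightarrow> (real^'n \<Rightarrow> real) set"
    and \<gamma> :: "(real^'n) set \<Rightarrow> real"
    and \<theta> :: real
  assumes "CARD('n) \<in> {1, 2, 3}"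
    and "regular_periodic_partition K"
    and "\<And>\<kappa>. \<kappa> \<in> K \<Longrightarrow> local_space \<kappa> (V \<kappa>)"
    and "\<And>\<kappa>. \<kappa> \<in> K \<Longrightarrow> \<gamma> \<kappa> > 0"
    and "\<And>\<kappa>. \<kappa> \<in> K \<Longrightarrow> ereal (\<gamma> \<kappa>) \<ge> ereal (1/2 * (1 + \<theta>)\<^sup>2) * (d_const \<kappa> (V \<kappa>))\<^sup>2"
  shows "\<forall>v \<in> dg_space K V. 1/2 * (dg_norm K \<gamma> v)\<^sup>2 \<le> dg_form K \<theta> \<gamma> v v"
proof
  fix v assume v: "v \<in> dg_space K V"
  let ?X = "\<lambda>\<kappa>. (L2_norm (lebesgue_on \<kappa>) (weak_grad \<kappa> v))\<^sup>2"
  let ?J = "\<lambda>\<kappa>. (L2_norm (surface \<kappa>) (jump K v))\<^sup>2"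
  let ?I = "\<lambda>\<kappa>. L2_inner (surface \<kappa>) (grad_trace \<kappa> v) (jump K v)"
  \<comment> \<open>On the diagonal the two flux terms of the form coincide and merge into
    \<open>(1 + \<theta>) / 2\<close> times one integral. The flux bound costs half of the gradient
    term and half of the penalty, and the remaining halves make up the left-hand side.\<close>
  have bound: "1/2 * (?X \<kappa> + \<gamma> \<kappa> / 2 * ?J \<kappa>) \<le> ?X \<kappa> - 1/2 * ?I \<kappa> - \<theta>/2 * ?I \<kappa> + \<gamma> \<kappa> / 2 * ?J \<kappa>"
    if \<kappa>: "\<kappa> \<in> K" for \<kappa>
  proof -
    from v \<kappa> obtain u where u: "u \<in> V \<kappa>" "AE x in lebesgue_on \<kappa>. v x = u x"
      by (auto simp: dg_space_def)
    have "(1 + \<theta>) / 2 * ?I \<kappa> \<le> 1/2 * ?X \<kappa> + \<gamma> \<kappa> / 4 * ?J \<kappa>"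
      using flux_term_bound[OF assms(2) \<kappa> assms(3-5)[OF \<kappa>] u] .
    then show ?thesis by (simp add: field_simps)
  qed
  have "(dg_norm K \<gamma> v)\<^sup>2 = (\<Sum>\<kappa>\<in>K. ?X \<kappa> + \<gamma> \<kappa> / 2 * ?J \<kappa>)"
    unfolding dg_norm_def using assms(4) by (intro real_sqrt_pow2 sum_nonneg) (simp add: less_imp_le)
  then have "1/2 * (dg_norm K \<gamma> v)\<^sup>2 \<le> (\<Sum>\<kappa>\<in>K. ?X \<kappa> - 1/2 * ?I \<kappa> - \<theta>/2 * ?I \<kappa> + \<gamma> \<kappa> / 2 * ?J \<kappa>)"
    using sum_mono[OF bound] by (simp add: sum_distrib_left)
  also have "\<dots> = dg_form K \<theta> \<gamma> v v"
    by (simp add: dg_form_def L2_norm_power2 L2_inner_def inner_commute)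
  finally show "1/2 * (dg_norm K \<gamma> v)\<^sup>2 \<le> dg_form K \<theta> \<gamma> v v" .
qed

end
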